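(* Let $V=\bigoplus_{q\ge 1,\epsilon\in\mathbb Z_2}V_{q,\epsilon}$ be a $\mathbb Z^+\times\mathbb Z_2$-graded vector space over $k$ with all $V_{q,\epsilon}$ finite-dimensional, with series $V(z,y)$, and let $T(V)$ be its tensor algebra. Then the series of $\overline{\mathrm{HC}}_0(T(V))=T(V)^+/[T(V),T(V)]$ is $$-\sum_{m=1}^\infty\frac{\phi(m)}{m}\log\bigl(1-V(z^m,(-1)^{m+1}y^m)\bigr),$$ where $\phi$ is Euler's $\phi$-function.
   Context: $k$ is a field of characteristic zero. The first grading ($q$) is called the weight and the second ($\epsilon$, written $|a|\in\mathbb Z_2$) the sign degree; both gradings extend additively to $T(V)$. $T(V)^+$ is the part of positive weight, and $[T(V),T(V)]$ is the linear subspace (not ideal) spanned by all graded commutators $ab-(-1)^{|a||b|}ba$ with $a,b$ homogeneous. The series of a bigraded space $W=\bigoplus_{q\ge1,\epsilon\in\mathbb Z_2}W_{q,\epsilon}$ with finite-dimensional components is $W(z,y)=\sum_{q,\epsilon}\dim_k(W_{q,\epsilon})\,z^qy^\epsilon\in\mathbb Z[[z]][y]/(y^2-1)$. For a series $X$ with constant term $1$ in $\mathbb Q[[z]][y]/(y^2-1)$, $\log(X)=-\sum_{j\ge1}(1-X)^j/j$. $V(z^m,(-1)^{m+1}y^m)$ is obtained from $V(z,y)$ by substituting $z^m$ for $z$ and $(-1)^{m+1}y^m$ for $y$. *)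

theory Defs
  imports
    "HOL-Library.Z2"
    "HOL-Library.Poly_Mapping"
    "HOL-Computational_Algebra.Formal_Power_Series"
    "HOL-Number_Theory.Totient"
    "HOL-Algebra.QuotRing"
    "Jordan_Normal_Form.VS_Connect"
begin

section \<open>Bigraded vector spaces\<close>

text \<open>
  A field \<open>k\<close> is a type of class \<open>field\<close>, seen as a ring record through \<open>class_ring\<close>;
  \<open>\<int>\<^sub>2\<close> is the type \<open>bit\<close>. A family \<open>W q e\<close> of subspaces is only looked at for \<open>q \<ge> 1\<close>,
  and \<open>M\<close> is required to be the direct sum of these: every vector is the sum of a unique
  finitely supported family of components.
\<close>

definition bidegrees :: "(nat \<times> bit) set" where
  "bidegrees = {1..} \<times> UNIV"

definition is_direct_sum :: "('k, 'v) module \<Rightarrow> (nat \<Rightarrow> bit \<Rightarrow> 'v set) \<Rightarrow> bool" where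
  "is_direct_sum M W \<longleftrightarrow>
     (\<forall>x \<in> carrier M. \<exists>!f. f \<in> (\<Pi>\<^sub>E d \<in> bidegrees. W (fst d) (snd d)) \<and>
        finite {d \<in> bidegrees. f d \<noteq> \<zero>\<^bsub>M\<^esub>} \<and>
        x = finsum M f {d \<in> bidegrees. f d \<noteq> \<zero>\<^bsub>M\<^esub>})"

definition fd_bigraded :: "('k::field, 'v) module \<Rightarrow> (nat \<Rightarrow> bit \<Rightarrow> 'v set) \<Rightarrow> bool" where
  "fd_bigraded M W \<longleftrightarrow>
     vectorspace class_ring M \<and>
     (\<forall>q\<ge>1. \<forall>e. VectorSpace.subspace class_ring (W q e) M \<and>
        vectorspace.fin_dim class_ring (M\<lparr>carrier := W q e\<rparr>)) \<and>
     is_direct_sum M W"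


section \<open>The tensor algebra\<close>

text \<open>
  Lists form a monoid under concatenation, so \<open>'v list \<Rightarrow>\<^sub>0 'k\<close>, with the convolution product of
  \<open>Poly_Mapping\<close>, is the algebra of noncommutative polynomials over \<open>'k\<close> in the letters \<open>'v\<close>.
\<close>

instantiation list :: (type) monoid_add
begin

definition zero_list :: "'a list" where
  "zero_list = []"

definition plus_list :: "'a list \<Rightarrow> 'a list \<Rightarrow> 'a list" where
  "plus_list xs ys = xs @ ys"

instance
  by standard (simp_all add: zero_list_def plus_list_def)

end

definition free_algebra :: "'v set \<Rightarrow> ('k::field, 'v list \<Rightarrow>\<^sub>0 'k) module" where
  "free_algebra X =
     \<lparr>carrier = {p. \<forall>w \<in> Poly_Mapping.keys p. set w \<subseteq> X},
      mult = (*), one = 1, zero = 0, add = (+),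
      smult = (\<lambda>c p. Poly_Mapping.single [] c * p)\<rparr>"

definition word :: "'v list \<Rightarrow> ('v list \<Rightarrow>\<^sub>0 'k::field)" where
  "word w = Poly_Mapping.single w 1"

text \<open>
  Quotient of \<open>A\<close> by \<open>N\<close>, with the cosets of \<open>N\<close> as elements. If \<open>N\<close> is a two-sided ideal that is
  also a linear subspace, this is a quotient algebra; if \<open>N\<close> is merely a linear subspace, it is a
  quotient vector space, and the fields \<open>mult\<close> and \<open>one\<close> have no meaning.
\<close>

definition quotient :: "('k, 'a) module \<Rightarrow> 'a set \<Rightarrow> ('k, 'a set) module" where
  "quotient A N =
     ring.extend (A Quot N)
       (module.fields (\<lambda>c X. \<Union>x\<in>X. N +>\<^bsub>A\<^esub> (c \<odot>\<^bsub>A\<^esub> x)))"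

text \<open>
  \<open>T(V)\<close> is the free algebra on the set \<open>V\<close> modulo the relations making \<open>v \<mapsto> [v]\<close> linear.
\<close>

definition tensor_relations :: "('k::field, 'v) module \<Rightarrow> ('v list \<Rightarrow>\<^sub>0 'k) set" where
  "tensor_relations V =
     {word [v \<oplus>\<^bsub>V\<^esub> w] - (word [v] + word [w]) | v w. v \<in> carrier V \<and> w \<in> carrier V} \<union>
     {word [c \<odot>\<^bsub>V\<^esub> v] - Poly_Mapping.single [] c * word [v] | c v. v \<in> carrier V}"

definition tensor_ideal :: "('k::field, 'v) module \<Rightarrow> ('v list \<Rightarrow>\<^sub>0 'k) set" where
  "tensor_ideal V = genideal (free_algebra (carrier V) :: ('k, _) module) (tensor_relations V)"

definition tensor_algebra :: "('k::field, 'v) module \<Rightarrow> ('k, ('v list \<Rightarrow>\<^sub>0 'k) set) module" where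
  "tensor_algebra V = quotient (free_algebra (carrier V)) (tensor_ideal V)"

text \<open>The pure tensor \<open>v\<^sub>1 \<otimes> \<dots> \<otimes> v\<^sub>r\<close> of a list \<open>[v\<^sub>1, \<dots>, v\<^sub>r]\<close> of vectors.\<close>

definition pure_tensor :: "('k::field, 'v) module \<Rightarrow> 'v list \<Rightarrow> ('v list \<Rightarrow>\<^sub>0 'k) set" where
  "pure_tensor V w =
     tensor_ideal V +>\<^bsub>(free_algebra (carrier V) :: ('k, _) module)\<^esub> word w"

definition homogeneous_lists :: "(nat \<Rightarrow> bit \<Rightarrow> 'v set) \<Rightarrow> nat \<Rightarrow> bit \<Rightarrow> 'v list set" where
  "homogeneous_lists G n e =
     {w. \<exists>ds. list_all2 (\<lambda>v d. d \<in> bidegrees \<and> v \<in> G (fst d) (snd d)) w ds \<and>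
        sum_list (map fst ds) = n \<and> sum_list (map snd ds) = e}"

definition tensor_component ::
  "('k::field, 'v) module \<Rightarrow> (nat \<Rightarrow> bit \<Rightarrow> 'v set) \<Rightarrow> nat \<Rightarrow> bit \<Rightarrow> ('v list \<Rightarrow>\<^sub>0 'k) set set" where
  "tensor_component V G n e =
     LinearCombinations.module.span class_ring (tensor_algebra V)
       (pure_tensor V ` homogeneous_lists G n e)"

definition tensor_plus ::
  "('k::field, 'v) module \<Rightarrow> (nat \<Rightarrow> bit \<Rightarrow> 'v set) \<Rightarrow> ('v list \<Rightarrow>\<^sub>0 'k) set set" where
  "tensor_plus V G =
     LinearCombinations.module.span class_ring (tensor_algebra V)
       (\<Union>(n, e) \<in> bidegrees. tensor_component V G n e)"


section \<open>Reduced cyclic homology in degree zero\<close>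

definition koszul_sign :: "bit \<Rightarrow> bit \<Rightarrow> 'k::field" where
  "koszul_sign d e = (if d = 1 \<and> e = 1 then - 1 else 1)"

definition commutator_space ::
  "('k::field, 'v) module \<Rightarrow> (nat \<Rightarrow> bit \<Rightarrow> 'v set) \<Rightarrow> ('v list \<Rightarrow>\<^sub>0 'k) set set" where
  "commutator_space V G =
     LinearCombinations.module.span class_ring (tensor_algebra V)
       {a \<otimes>\<^bsub>tensor_algebra V\<^esub> b \<ominus>\<^bsub>tensor_algebra V\<^esub>
          (koszul_sign d e \<odot>\<^bsub>tensor_algebra V\<^esub> (b \<otimes>\<^bsub>tensor_algebra V\<^esub> a)) | a b m d n e.
        a \<in> tensor_component V G m d \<and> b \<in> tensor_component V G n e}"

definition HC0 ::
  "('k::field, 'v) module \<Rightarrow> (nat \<Rightarrow> bit \<Rightarrow> 'v set) \<Rightarrow>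
     ('k, ('v list \<Rightarrow>\<^sub>0 'k) set set) module" where
  "HC0 V G =
     quotient ((tensor_algebra V)\<lparr>carrier := tensor_plus V G\<rparr>) (commutator_space V G)"

definition HC0_component ::
  "('k::field, 'v) module \<Rightarrow> (nat \<Rightarrow> bit \<Rightarrow> 'v set) \<Rightarrow> nat \<Rightarrow> bit \<Rightarrow>
     ('v list \<Rightarrow>\<^sub>0 'k) set set set" where
  "HC0_component V G n e =
     (\<lambda>x. commutator_space V G +>\<^bsub>tensor_algebra V\<^esub> x) ` tensor_component V G n e"


section \<open>Series\<close>

text \<open>
  \<open>bit \<Rightarrow>\<^sub>0 rat\<close> is the group algebra of \<open>\<int>\<^sub>2\<close>, that is \<open>\<rat>[y]/(y\<^sup>2 - 1)\<close> with
  \<open>y = Poly_Mapping.single 1 1\<close>. Hence the power series over it form \<open>\<rat>[[z]][y]/(y\<^sup>2 - 1)\<close>.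
  Infinite sums are taken in the \<open>z\<close>-adic metric of \<open>Formal_Power_Series\<close>.
\<close>

type_synonym series = "(bit \<Rightarrow>\<^sub>0 rat) fps"

definition y_var :: "bit \<Rightarrow>\<^sub>0 rat" where
  "y_var = Poly_Mapping.single 1 1"

lemma y_var_square: "y_var\<^sup>2 = 1"
  by (simp add: y_var_def power2_eq_square mult_single)

definition y_const :: "rat \<Rightarrow> bit \<Rightarrow>\<^sub>0 rat" where
  "y_const c = Poly_Mapping.single 0 c"

definition series_const :: "rat \<Rightarrow> series" where
  "series_const c = fps_const (y_const c)"

definition bigraded_series :: "('k::field, 'v) module \<Rightarrow> (nat \<Rightarrow> bit \<Rightarrow> 'v set) \<Rightarrow> series" where
  "bigraded_series M W =
     Abs_fps (\<lambda>q. if q = 0 then 0 else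
       y_const (of_nat (vectorspace.dim class_ring (M\<lparr>carrier := W q 0\<rparr>))) +
       y_const (of_nat (vectorspace.dim class_ring (M\<lparr>carrier := W q 1\<rparr>))) * y_var)"

text \<open>Replace \<open>y\<close> by \<open>u\<close>; this is a ring homomorphism when \<open>u\<^sup>2 = 1\<close>.\<close>

definition subst_y :: "(bit \<Rightarrow>\<^sub>0 rat) \<Rightarrow> (bit \<Rightarrow>\<^sub>0 rat) \<Rightarrow> (bit \<Rightarrow>\<^sub>0 rat)" where
  "subst_y u a = y_const (Poly_Mapping.lookup a 0) + y_const (Poly_Mapping.lookup a 1) * u"

text \<open>\<open>X(z\<^sup>m, (-1)\<^sup>m\<^sup>+\<^sup>1 y\<^sup>m)\<close>\<close>

definition series_subst :: "nat \<Rightarrow> series \<Rightarrow> series" where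
  "series_subst m X =
     Abs_fps (\<lambda>n. subst_y ((- 1) ^ (m + 1) * y_var ^ m) (fps_nth X n)) oo fps_X ^ m"

definition series_log :: "series \<Rightarrow> series" where
  "series_log X = - suminf (\<lambda>j. series_const (1 / of_nat (Suc j)) * (1 - X) ^ Suc j)"

end

theory Submission
  imports Defs
begin

text \<open>
  Choose a homogeneous basis \<open>X\<close> of \<open>V\<close>. Then \<open>T(V)\<close> has the words over \<open>X\<close> as a basis
  (\<open>tensor_ideal_eq\<close>, \<open>coord_image\<close>), and in \<open>T(V)\<^sup>+ / [T(V), T(V)]\<close> a word \<open>u v\<close> is identified with \<open>v u\<close> up to
  the Koszul sign.

  Instead of counting the cyclic words that survive these identifications, the proof uses a trace. Let \<open>P\<close> send
  a word \<open>w\<close> of length \<open>r \<ge> 1\<close> to the signed average of its \<open>r\<close> rotations. In characteristic zero \<open>P\<close> is an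
  idempotent (\<open>cyclic_mean_idem\<close>) and its kernel on \<open>T(V)\<^sup>+\<close> is the commutator space
  (\<open>span_commutators_eq\<close>). Hence the quotient is isomorphic to the image of \<open>P\<close>, and its dimension in a given
  bidegree is the trace of \<open>P\<close> there (\<open>dim_image_idempotent_eq_trace\<close>): the sum over the words \<open>w\<close> of that
  bidegree of \<open>1/r\<close> times the sum of the signs of the rotations that fix \<open>w\<close>.

  A rotation by \<open>i\<close> letters, \<open>1 \<le> i \<le> r\<close>, fixes \<open>w\<close> if and only if \<open>w = u\<^sup>m\<close> and \<open>i = t |u|\<close> with \<open>t \<le> m\<close> coprime to
  \<open>m\<close>, where \<open>|u|\<close> is the length of \<open>u\<close>, and then \<open>(m, u, t)\<close> is unique. So each pair \<open>(m, u)\<close> accounts for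
  \<open>\<phi>(m)\<close> rotations; each has the sign \<open>(-1)\<^sup>m\<^sup>+\<^sup>1\<close> if \<open>u\<close> is odd and \<open>1\<close> if \<open>u\<close> is even
  (\<open>koszul_sign_power\<close>). Since \<open>r = m |u|\<close>, the series of all traces is the sum over \<open>m\<close> and \<open>j\<close> of
  \<open>\<phi>(m)/m \<cdot> 1/j\<close> times the sum over the words \<open>u\<close> of length \<open>j\<close> of the bidegree monomial of \<open>u\<close> with \<open>z\<^sup>m\<close> for \<open>z\<close> and
  \<open>(-1)\<^sup>m\<^sup>+\<^sup>1 y\<^sup>m\<close> for \<open>y\<close> (\<open>sum_over_fixed_rotations\<close>). That last sum is the \<open>j\<close>-th power of
  \<open>V(z\<^sup>m, (-1)\<^sup>m\<^sup>+\<^sup>1 y\<^sup>m)\<close>, and summing over \<open>j\<close> gives the logarithm (\<open>trace_series_sums\<close>).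
\<close>


section \<open>Powers of words\<close>

abbreviation word_power :: "nat \<Rightarrow> 'a list \<Rightarrow> 'a list" where
  "word_power m u \<equiv> concat (replicate m u)"

lemma word_power_add: "word_power (a + b) u = word_power a u @ word_power b u"
  by (simp add: replicate_add)

lemma word_power_mult: "word_power a (word_power b u) = word_power (a * b) u"
  by (induction a) (simp_all add: replicate_add)

lemma length_word_power: "length (word_power m u) = m * length u"
  by (induction m) simp_all

lemma take_drop_word_power:
  assumes "t \<le> m"
  shows "take (t * length u) (word_power m u) = word_power t u"
    and "drop (t * length u) (word_power m u) = word_power (m - t) u"
proof -
  have "word_power m u = word_power t u @ word_power (m - t) u"
    using word_power_add[of t "m - t" u] assms by simp
  then show "take (t * length u) (word_power m u) = word_power t u"
    and "drop (t * length u) (word_power m u) = word_power (m - t) u"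
    by (simp_all add: length_word_power)
qed

text \<open>
  A rotation fixes \<open>w\<close> exactly when its two halves commute, and commuting words are powers of a
  common word. Passing to the power given by the gcd of the two exponents makes the exponents coprime,
  and with this choice the parameters \<open>(m, u, t)\<close> are determined by \<open>(w, i)\<close>.
\<close>

lemma fixed_rotation_is_power:
  assumes i: "1 \<le> i" "i \<le> length w" and fixed: "drop i w @ take i w = w"
  shows "\<exists>m u t. w = word_power m u \<and> i = t * length u \<and> t \<in> totatives m \<and> u \<noteq> []"
proof -
  have "take i w @ drop i w = drop i w @ take i w" using fixed by simp
  from comm_append_are_replicate[OF this]
  obtain p q z where pq: "word_power p z = take i w" "word_power q z = drop i w"
    by blast
  have ne: "take i w \<noteq> []" using i by auto
  then have p: "p > 0" and z: "z \<noteq> []" using pq(1) by (auto intro!: gr0I)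
  define h where "h = gcd p q"
  have h: "h > 0" using p by (simp add: h_def)
  define t where "t = p div h"
  define s where "s = q div h"
  have ts: "p = t * h" "q = s * h" by (simp_all add: t_def s_def h_def)
  have cop: "coprime t s"
    unfolding t_def s_def h_def using p by (intro div_gcd_coprime) auto
  define u where "u = word_power h z"
  have tu: "take i w = word_power t u" and su: "drop i w = word_power s u"
    using pq by (simp_all add: ts u_def word_power_mult)
  have "w = word_power (t + s) u"
    by (metis append_take_drop_id tu su word_power_add)
  moreover have "i = t * length u"
    using arg_cong[OF tu, of length] i by (simp add: length_word_power)
  moreover have "t \<in> totatives (t + s)"
    using p ts cop by (auto simp: totatives_def coprime_iff_gcd_eq_1 intro!: gr0I)
  moreover have "u \<noteq> []" using h z by (cases h) (auto simp: u_def)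
  ultimately show ?thesis by blast
qed

lemma sum_list_word_power:
  "sum_list (map f (word_power m u)) = of_nat m * (sum_list (map f u) :: 'b::semiring_1)"
  by (induction m) (simp_all add: algebra_simps)


section \<open>Series with coefficients in \<open>\<rat>[y]/(y\<^sup>2 - 1)\<close>\<close>

lemma y_const_simps:
  "y_const 0 = 0" "y_const 1 = 1" "y_const (a + b) = y_const a + y_const b"
  "y_const (a * b) = y_const a * y_const b" "y_const (- a) = - y_const a"
  by (simp_all add: y_const_def single_add mult_single single_uminus flip: single_one)

lemma y_const_sum: "y_const (sum f S) = (\<Sum>x\<in>S. y_const (f x))"
  by (induction S rule: infinite_finite_induct) (simp_all add: y_const_simps)

lemma y_const_of_nat: "y_const (of_nat n) = of_nat n"
  by (induction n) (simp_all add: y_const_simps)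

lemma subst_y_linear: "subst_y u (y_const a + y_const b * y_var) = y_const a + y_const b * u"
  by (simp add: subst_y_def y_const_def y_var_def mult_single lookup_add lookup_single when_def)

text \<open>The image of \<open>y\<^sup>e\<close> under the substitution of \<open>(-1)\<^sup>m\<^sup>+\<^sup>1 y\<^sup>m\<close> for \<open>y\<close>.\<close>

definition y_power :: "nat \<Rightarrow> bit \<Rightarrow> (bit \<Rightarrow>\<^sub>0 rat)" where
  "y_power m e = (if e = 0 then 1 else (- 1) ^ (m + 1) * y_var ^ m)"

lemma y_power_simps: "y_power m 0 = 1" "y_power 1 1 = y_var" "y_power (Suc 0) 1 = y_var"
  by (simp_all add: y_power_def)

lemma y_power_add: "y_power m (d + e) = y_power m d * y_power m e"
proof -
  have "((- 1) ^ (m + 1) * y_var ^ m) * ((- 1) ^ (m + 1) * y_var ^ m)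
      = ((- 1) * (- 1)) ^ (m + 1) * (y_var * y_var) ^ m"
    by (simp only: power_mult_distrib mult.assoc mult.left_commute)
  also have "\<dots> = 1"
    by (simp add: y_var_square flip: power2_eq_square)
  finally have "((- 1) ^ (m + 1) * y_var ^ m) * ((- 1) ^ (m + 1) * y_var ^ m) = 1" .
  then show ?thesis
    by (cases d; cases e) (simp_all add: y_power_def)
qed

text \<open>
  This is where the substitution \<open>(-1)\<^sup>m\<^sup>+\<^sup>1 y\<^sup>m\<close> comes from. Moving \<open>t\<close> of the \<open>m\<close> blocks of \<open>u\<^sup>m\<close>,
  with \<open>u\<close> of sign degree \<open>e\<close>, past the other \<open>m - t\<close> costs the sign \<open>(-1)\<close> to the power \<open>t (m - t) e\<close>. As \<open>t\<close> is
  coprime to \<open>m\<close>, the number \<open>t (m - t)\<close> is odd if and only if \<open>m\<close> is even.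
\<close>

lemma koszul_sign_power:
  assumes t: "t \<in> totatives m"
  shows "y_const (koszul_sign (of_nat t * e) (of_nat (m - t) * e)) * y_power 1 (of_nat m * e)
    = y_power m e"
proof (cases "e = 0")
  case True
  then show ?thesis by (simp add: koszul_sign_def y_power_def y_const_simps)
next
  case False
  then have e: "e = 1" by (cases e) auto
  have tm: "t \<le> m" "coprime t m" using t by (auto simp: totatives_def)
  have par: "(of_nat k :: bit) = (if even k then 0 else 1)" for k
    by (induction k) auto
  show ?thesis
  proof (cases "even m")
    case True
    then have "odd t" using tm by (meson coprime_common_divisor_nat odd_one coprime_def dvd_trans)
    moreover from this True tm have "odd (m - t)" by simp
    moreover obtain k where "m = 2 * k" using True by blast
    ultimately show ?thesis
      by (simp add: e koszul_sign_def par y_power_def y_const_simps power_mult y_var_square)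
  next
    case False
    then have "even t \<or> even (m - t)" using tm by auto
    moreover obtain k where "m = 2 * k + 1" using False by (elim oddE)
    ultimately show ?thesis
      by (auto simp: e koszul_sign_def par y_power_def y_const_simps power_mult y_var_square)
  qed
qed

text \<open>
  In the \<open>z\<close>-adic metric a sum converges as soon as each coefficient is affected by finitely many terms.
\<close>

lemma fps_sums_nth:
  fixes f :: "nat \<Rightarrow> 'a::comm_ring_1 fps"
  assumes "\<And>n j. j \<ge> n \<Longrightarrow> fps_nth (f j) n = 0"
  shows "f sums Abs_fps (\<lambda>n. \<Sum>j<n. fps_nth (f j) n)"
  unfolding sums_def tendsto_fps_iff
proof
  fix n
  have "fps_nth (\<Sum>j<N. f j) n = (\<Sum>j<n. fps_nth (f j) n)" if "N \<ge> n" for N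
    unfolding fps_sum_nth using that assms by (intro sum.mono_neutral_right) auto
  then show "\<forall>\<^sub>F N in sequentially.
      fps_nth (\<Sum>j<N. f j) n = fps_nth (Abs_fps (\<lambda>n. \<Sum>j<n. fps_nth (f j) n)) n"
    by (intro eventually_sequentiallyI[of n]) simp
qed

lemma series_log_nth:
  assumes "fps_nth Y 0 = 0"
  shows "fps_nth (series_log (1 - Y)) n
    = - (\<Sum>j<n. y_const (1 / of_nat (Suc j)) * fps_nth (Y ^ Suc j) n)"
proof -
  have "(\<lambda>j. series_const (1 / of_nat (Suc j)) * (1 - (1 - Y)) ^ Suc j) sums
      Abs_fps (\<lambda>n. \<Sum>j<n. fps_nth (series_const (1 / of_nat (Suc j)) * (1 - (1 - Y)) ^ Suc j) n)"
  proof (rule fps_sums_nth)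
    fix n j :: nat assume "j \<ge> n"
    then have "fps_nth (Y ^ Suc j) n = 0"
      using startsby_zero_power_prefix[OF assms, of "Suc j"] by simp
    then show "fps_nth (series_const (1 / of_nat (Suc j)) * (1 - (1 - Y)) ^ Suc j) n = 0"
      unfolding series_const_def fps_mult_left_const_nth by simp
  qed
  then show ?thesis
    unfolding series_log_def by (simp add: series_const_def flip: sums_unique)
qed


section \<open>Words with a fixed rotation, and the logarithmic series\<close>

locale graded_alphabet =
  fixes X :: "'v set" and wt :: "'v \<Rightarrow> nat" and par :: "'v \<Rightarrow> bit"
  assumes wt_pos: "x \<in> X \<Longrightarrow> 1 \<le> wt x"
    and finite_letters: "finite {x \<in> X. wt x = q}"
begin

abbreviation weight :: "'v list \<Rightarrow> nat" where "weight w \<equiv> sum_list (map wt w)"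
abbreviation parity :: "'v list \<Rightarrow> bit" where "parity w \<equiv> sum_list (map par w)"

lemma length_le_weight: "w \<in> lists X \<Longrightarrow> length w \<le> weight w"
  by (induction w) (use wt_pos in \<open>fastforce+\<close>)

lemma finite_words: "finite {w \<in> lists X. weight w = n}"
proof (rule finite_subset)
  show "{w \<in> lists X. weight w = n} \<subseteq> {w. set w \<subseteq> {x \<in> X. wt x \<le> n} \<and> length w \<le> n}"
    using length_le_weight by (fastforce simp: member_le_sum_list)
  have "{x \<in> X. wt x \<le> n} = (\<Union>q\<le>n. {x \<in> X. wt x = q})" by auto
  then have "finite {x \<in> X. wt x \<le> n}" using finite_letters by simp
  then show "finite {w. set w \<subseteq> {x \<in> X. wt x \<le> n} \<and> length w \<le> n}"
    by (rule finite_lists_length_le)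
qed

definition letter_series :: series where
  "letter_series = Abs_fps (\<lambda>q. if q = 0 then 0 else
     y_const (of_nat (card {x \<in> X. wt x = q \<and> par x = 0})) +
     y_const (of_nat (card {x \<in> X. wt x = q \<and> par x = 1})) * y_var)"

lemma finite_words_scaled:
  assumes "m \<ge> 1"
  shows "finite {w \<in> lists X. m * weight w = n}"
  by (rule finite_subset[OF _ finite_words[of "n div m"]]) (use assms in auto)

lemma series_subst_letters_nth:
  assumes m: "m \<ge> 1"
  shows "fps_nth (series_subst m letter_series) n = (\<Sum>x | x \<in> X \<and> m * wt x = n. y_power m (par x))"
proof -
  let ?u = "(- 1) ^ (m + 1) * y_var ^ m :: bit \<Rightarrow>\<^sub>0 rat"
  have coeff: "subst_y ?u (fps_nth letter_series q) = (\<Sum>x | x \<in> X \<and> wt x = q. y_power m (par x))"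
    for q
  proof (cases "q = 0")
    case True
    then have "(\<Sum>x | x \<in> X \<and> wt x = q. y_power m (par x)) = 0"
      by (intro sum.neutral) (use wt_pos in fastforce)
    then show ?thesis using True
      by (simp add: letter_series_def subst_y_def y_const_simps)
  next
    case False
    let ?S = "\<lambda>e. {x \<in> X. wt x = q \<and> par x = e}"
    have split: "{x. x \<in> X \<and> wt x = q} = ?S 0 \<union> ?S 1"
      using bit_not_zero_iff by blast
    have fin: "finite (?S e)" for e
      by (rule finite_subset[OF _ finite_letters[of q]]) auto
    have "(\<Sum>x | x \<in> X \<and> wt x = q. y_power m (par x))
        = (\<Sum>x\<in>?S 0. y_power m (par x)) + (\<Sum>x\<in>?S 1. y_power m (par x))"
      unfolding split by (rule sum.union_disjoint) (use fin in auto)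
    also have "\<dots> = of_nat (card (?S 0)) + of_nat (card (?S 1)) * ?u"
      by (simp add: y_power_def)
    finally show ?thesis using False
      by (simp only: letter_series_def fps_nth_Abs_fps if_False subst_y_linear)
        (simp only: y_const_of_nat)
  qed
  show ?thesis
  proof (cases "m dvd n")
    case True
    then obtain q where q: "n = m * q" by blast
    have *: "fps_nth ((fps_X ^ m) ^ i) n = (if i = q then 1 else 0 :: bit \<Rightarrow>\<^sub>0 rat)" for i
      using m by (simp add: fps_X_power_nth q flip: power_mult)
    have "q \<le> n" using m q by simp
    then have "fps_nth (series_subst m letter_series) n = subst_y ?u (fps_nth letter_series q)"
      unfolding series_subst_def fps_compose_nth * by (simp add: if_distrib cong: if_cong)
    then show ?thesis unfolding coeff using m by (simp add: q)
  next
    case False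
    then have *: "fps_nth ((fps_X ^ m) ^ i) n = (0 :: bit \<Rightarrow>\<^sub>0 rat)" for i
      by (auto simp: fps_X_power_nth simp flip: power_mult)
    have "(\<Sum>x | x \<in> X \<and> m * wt x = n. y_power m (par x)) = 0"
      by (rule sum.neutral) (use False in auto)
    then show ?thesis
      unfolding series_subst_def fps_compose_nth * by simp
  qed
qed

text \<open>
  The \<open>j\<close>-th power of the series of the letters enumerates the words of length \<open>j\<close>.
\<close>

lemma series_subst_letters_power_nth:
  assumes m: "m \<ge> 1"
  shows "fps_nth (series_subst m letter_series ^ j) n
    = (\<Sum>w | w \<in> lists X \<and> length w = j \<and> m * weight w = n. y_power m (parity w))"
proof (induction j arbitrary: n)
  case 0
  have "{w. w \<in> lists X \<and> length w = 0 \<and> m * weight w = n} = (if n = 0 then {[]} else {})"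
    by auto
  then show ?case by (simp add: y_power_simps)
next
  case (Suc j)
  let ?W = "\<lambda>j n. {w. w \<in> lists X \<and> length w = j \<and> m * weight w = n}"
  let ?L = "\<lambda>i. {x. x \<in> X \<and> m * wt x = i}"
  have finW: "finite (?W j n)" for j n
    by (rule finite_subset[OF _ finite_words_scaled[OF m, of n]]) auto
  have finL: "finite (?L i)" for i
    by (rule finite_subset[OF _ finite_letters[of "i div m"]]) (use m in auto)
  have "fps_nth (series_subst m letter_series ^ Suc j) n
      = (\<Sum>i=0..n. \<Sum>x\<in>?L i. \<Sum>w\<in>?W j (n - i). y_power m (par x) * y_power m (parity w))"
    unfolding power_Suc fps_mult_nth Suc.IH series_subst_letters_nth[OF m] sum_product ..
  also have "\<dots> = (\<Sum>(i, x, w)\<in>(SIGMA i:{0..n}. ?L i \<times> ?W j (n - i)).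
      y_power m (par x) * y_power m (parity w))"
    using finL finW by (simp add: sum.cartesian_product sum.Sigma)
  also have "\<dots> = (\<Sum>w\<in>?W (Suc j) n. y_power m (parity w))"
  proof (rule sum.reindex_bij_witness[where j = "\<lambda>(i, x, w). x # w"
        and i = "\<lambda>w. (m * wt (hd w), hd w, tl w)"], goal_cases)
    case (4 w)
    then show ?case by (cases w) (auto simp: algebra_simps)
  next
    case (3 w)
    then show ?case by (cases w) auto
  next
    case (5 p)
    then show ?case by (cases p) (simp only: y_power_add list.map sum_list.Cons prod.case)
  qed (auto simp: distrib_left)
  finally show ?case .
qed

definition fixed_rotations :: "'v list \<Rightarrow> nat set" where
  "fixed_rotations w = {i \<in> {1..length w}. drop i w @ take i w = w}"

text \<open>
  The coefficient of \<open>w\<close> in its own signed average over all rotations. The rotation by the whole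
  length, which is the identity, is counted instead of the rotation by \<open>0\<close>, so that the index runs
  through the same range as the totatives of a number.
\<close>

definition rotation_trace :: "'v list \<Rightarrow> 'k::field" where
  "rotation_trace w = (1 / of_nat (length w)) *
     (\<Sum>i\<in>fixed_rotations w. koszul_sign (parity (take i w)) (parity (drop i w)))"

definition trace_series :: series where
  "trace_series = Abs_fps (\<lambda>n. if n = 0 then 0 else
     y_const (\<Sum>w | w \<in> lists X \<and> weight w = n \<and> parity w = 0. rotation_trace w) +
     y_const (\<Sum>w | w \<in> lists X \<and> weight w = n \<and> parity w = 1. rotation_trace w) * y_var)"

lemma finite_fixed_rotations: "finite (fixed_rotations w)"
  by (simp add: fixed_rotations_def)

lemma trace_series_nth:
  assumes "n \<ge> 1"
  shows "fps_nth trace_series n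
    = (\<Sum>w | w \<in> lists X \<and> weight w = n. y_const (rotation_trace w) * y_power 1 (parity w))"
proof -
  let ?S = "\<lambda>e. {w. w \<in> lists X \<and> weight w = n \<and> parity w = e}"
  have split: "{w. w \<in> lists X \<and> weight w = n} = ?S 0 \<union> ?S 1"
    using bit_not_zero_iff by blast
  have fin: "finite (?S e)" for e
    by (rule finite_subset[OF _ finite_words[of n]]) auto
  have "(\<Sum>w | w \<in> lists X \<and> weight w = n. y_const (rotation_trace w) * y_power 1 (parity w))
      = (\<Sum>w\<in>?S 0. y_const (rotation_trace w) * y_power 1 (parity w))
        + (\<Sum>w\<in>?S 1. y_const (rotation_trace w) * y_power 1 (parity w))"
    unfolding split by (rule sum.union_disjoint) (use fin in auto)
  also have "\<dots> = (\<Sum>w\<in>?S 0. y_const (rotation_trace w))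
        + (\<Sum>w\<in>?S 1. y_const (rotation_trace w)) * y_var"
    by (simp add: y_power_simps sum_distrib_right)
  finally show ?thesis
    using assms by (simp add: trace_series_def y_const_sum)
qed

text \<open>
  The heart of the computation. Both sides are sums over triples \<open>(m, u, t)\<close> with \<open>t\<close> a totative of \<open>m\<close>:
  the map \<open>(m, u, t) \<mapsto> (u\<^sup>m, t |u|)\<close>, where \<open>|u|\<close> is the length, is a bijection onto the pairs of a word and a
  rotation that fixes it. The factor \<open>1 / |u\<^sup>m| = 1 / (m |u|)\<close> supplies the \<open>1 / m\<close> in front of the
  logarithm and the \<open>1 / j\<close> inside it.
\<close>

lemma sum_over_fixed_rotations:
  assumes n: "n \<ge> 1"
  shows "(\<Sum>w | w \<in> lists X \<and> weight w = n. y_const (rotation_trace w) * y_power 1 (parity w))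
    = (\<Sum>m=1..n. \<Sum>u | u \<in> lists X \<and> m * weight u = n.
        y_const (of_nat (totient m) / (of_nat m * of_nat (length u))) * y_power m (parity u))"
proof -
  let ?R = "SIGMA w:{w. w \<in> lists X \<and> weight w = n}. fixed_rotations w"
  let ?U = "\<lambda>m. {u. u \<in> lists X \<and> m * weight u = n}"
  let ?T = "SIGMA m:{1..n}. ?U m \<times> totatives m"
  let ?f = "\<lambda>(w, i). y_const (1 / of_nat (length w)) *
    (y_const (koszul_sign (parity (take i w)) (parity (drop i w))) * y_power 1 (parity w))"
  let ?g = "\<lambda>(m, u, t). (word_power m u, t * length u)"
  \<comment> \<open>the empty word has weight \<open>0\<close>, so \<open>n \<ge> 1\<close> keeps it out of both sums\<close>
  have finU: "finite (?U m)" if "m \<in> {1..n}" for m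
    using finite_words_scaled[of m n] that by simp
  have ne: "u \<noteq> []" if "u \<in> ?U m" for u m using that n by auto
  have "(\<Sum>w | w \<in> lists X \<and> weight w = n. y_const (rotation_trace w) * y_power 1 (parity w))
      = (\<Sum>w | w \<in> lists X \<and> weight w = n. \<Sum>i\<in>fixed_rotations w. ?f (w, i))"
    by (simp only: rotation_trace_def y_const_simps(4) y_const_sum sum_distrib_left
        sum_distrib_right mult.assoc prod.case)
  also have "\<dots> = sum ?f ?R"
    using finite_words finite_fixed_rotations by (simp add: sum.Sigma)
  also have "?R = ?g ` ?T"
  proof (intro equalityI subsetI)
    fix r assume "r \<in> ?R"
    then obtain w i where r: "r = (w, i)" and w: "w \<in> lists X" "weight w = n"
      and i: "1 \<le> i" "i \<le> length w" "drop i w @ take i w = w"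
      by (auto simp: fixed_rotations_def)
    from fixed_rotation_is_power[OF i] obtain m u t where
      mut: "w = word_power m u" "i = t * length u" "t \<in> totatives m" "u \<noteq> []" by blast
    have m: "m \<ge> 1" using mut(3) by (auto simp: totatives_def)
    then have u: "u \<in> lists X" using w(1) mut(1) by (cases m) auto
    have wu: "m * weight u = n" using w(2) mut(1) by (simp add: sum_list_word_power)
    have "weight u \<ge> 1" using wu n by (cases "weight u") auto
    then have "m \<le> n" using wu by (metis mult.right_neutral mult_le_mono2)
    then have "(m, u, t) \<in> ?T" using m u wu mut(3) by simp
    moreover have "r = ?g (m, u, t)" using r mut(1,2) by simp
    ultimately show "r \<in> ?g ` ?T" by (rule rev_image_eqI)
  next
    fix r assume "r \<in> ?g ` ?T"
    then obtain p where p: "p \<in> ?T" "r = ?g p" by blast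
    obtain m u t where p': "p = (m, u, t)" by (cases p)
    have r: "r = (word_power m u, t * length u)" and m: "m \<ge> 1"
      and u: "u \<in> ?U m" and t: "t \<in> totatives m" using p by (simp_all add: p')
    have tm: "t \<ge> 1" "t \<le> m" using t by (auto simp: totatives_def)
    have "word_power (m - t) u @ word_power t u = word_power m u"
      using tm by (simp flip: word_power_add)
    then have "t * length u \<in> fixed_rotations (word_power m u)"
      using tm ne[OF u] by (auto simp: fixed_rotations_def length_word_power take_drop_word_power
          Suc_le_eq)
    moreover have "word_power m u \<in> lists X" using u by (auto simp: in_lists_conv_set)
    ultimately show "r \<in> ?R" using u by (simp add: r sum_list_word_power)
  qed
  also have "sum ?f (?g ` ?T) = sum (?f \<circ> ?g) ?T"
  proof (rule sum.reindex, rule inj_onI)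
    fix p q assume p: "p \<in> ?T" and q: "q \<in> ?T" and eq: "?g p = ?g q"
    obtain m u t where p': "p = (m, u, t)" by (cases p)
    obtain m' u' t' where q': "q = (m', u', t')" by (cases q)
    have *: "u \<noteq> []" "coprime t m" "u' \<noteq> []" "coprime t' m'" "m \<ge> 1" "m' \<ge> 1"
      using p q ne by (auto simp: p' q' totatives_def)
    have w: "word_power m u = word_power m' u'" and i: "t * length u = t' * length u'"
      using eq by (auto simp: p' q')
    have r: "m * length u = m' * length u'" using arg_cong[OF w, of length]
      by (simp add: length_word_power)
    \<comment> \<open>the block length is the gcd of the rotation and the length of the whole word\<close>
    have gl: "gcd (a * l) (b * l) = l" if "coprime a b" for a b l :: nat
      using that gcd_mult_distrib_nat[of l a b] by (simp add: mult.commute)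
    have len: "length u = length u'"
      using gl[OF *(2), of "length u"] gl[OF *(4), of "length u'"] unfolding i r by simp
    then have "m = m'" "t = t'" using r i * by auto
    moreover have "u = u'"
      using take_drop_word_power(1)[of 1 m u] take_drop_word_power(1)[of 1 m' u'] w len *(5,6)
      by simp
    ultimately show "p = q" by (simp add: p' q')
  qed
  also have "\<dots> = (\<Sum>(m, u, t)\<in>?T. y_const (1 / (of_nat m * of_nat (length u))) * y_power m (parity u))"
  proof (rule sum.cong[OF refl], clarify)
    fix m u t assume t: "t \<in> totatives m"
    then have tm: "t \<le> m" by (auto simp: totatives_def)
    show "(?f \<circ> ?g) (m, u, t) = y_const (1 / (of_nat m * of_nat (length u))) * y_power m (parity u)"
      using koszul_sign_power[OF t, of "parity u"] tm
      by (simp add: take_drop_word_power length_word_power sum_list_word_power)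
  qed
  also have "\<dots> = (\<Sum>m=1..n. \<Sum>u\<in>?U m. \<Sum>t\<in>totatives m.
      y_const (1 / (of_nat m * of_nat (length u))) * y_power m (parity u))"
    unfolding sum.cartesian_product
    by (subst sum.Sigma) (use finU in \<open>auto simp: split_beta\<close>)
  also have "\<dots> = (\<Sum>m=1..n. \<Sum>u\<in>?U m.
      y_const (of_nat (totient m) / (of_nat m * of_nat (length u))) * y_power m (parity u))"
  proof (intro sum.cong refl)
    fix m and u :: "'v list"
    have "y_const (of_nat (totient m) / (of_nat m * of_nat (length u)))
        = of_nat (totient m) * y_const (1 / (of_nat m * of_nat (length u)))"
      unfolding y_const_of_nat[symmetric] y_const_simps(4)[symmetric] by simp
    then show "(\<Sum>t\<in>totatives m. y_const (1 / (of_nat m * of_nat (length u))) * y_power m (parity u))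
        = y_const (of_nat (totient m) / (of_nat m * of_nat (length u))) * y_power m (parity u)"
      by (simp add: totient_def mult.assoc)
  qed
  finally show ?thesis .
qed

text \<open>
  In weight \<open>n\<close> only the terms with \<open>m \<le> n\<close> of the outer sum contribute, and only the words of length
  at most \<open>n\<close> in each logarithm.
\<close>

theorem trace_series_sums:
  "(\<lambda>m. - (series_const (of_nat (totient (Suc m)) / of_nat (Suc m)) *
       series_log (1 - series_subst (Suc m) letter_series))) sums trace_series"
proof -
  let ?F = "\<lambda>m. - (series_const (of_nat (totient (Suc m)) / of_nat (Suc m)) *
       series_log (1 - series_subst (Suc m) letter_series))"
  let ?U = "\<lambda>m n. {u. u \<in> lists X \<and> m * weight u = n}"
  have const0: "fps_nth (series_subst (Suc m) letter_series) 0 = 0" for m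
  proof -
    have "(\<Sum>x | x \<in> X \<and> Suc m * wt x = 0. y_power (Suc m) (par x)) = 0"
      by (intro sum.neutral) (use wt_pos in fastforce)
    then show ?thesis using series_subst_letters_nth[of "Suc m" 0] by simp
  qed
  have nth: "fps_nth (?F m) n = (\<Sum>u\<in>?U (Suc m) n.
      y_const (of_nat (totient (Suc m)) / (of_nat (Suc m) * of_nat (length u)))
        * y_power (Suc m) (parity u))" if n: "n \<ge> 1" for m n
  proof -
    let ?c = "of_nat (totient (Suc m)) / of_nat (Suc m) :: rat"
    have m1: "1 \<le> Suc m" by simp
    have "fps_nth (?F m) n = (\<Sum>j<n. \<Sum>u | u \<in> lists X \<and> length u = Suc j \<and> Suc m * weight u = n.
        y_const ?c * (y_const (1 / of_nat (Suc j)) * y_power (Suc m) (parity u)))"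
      unfolding fps_neg_nth series_const_def fps_mult_left_const_nth series_log_nth[OF const0]
        series_subst_letters_power_nth[OF m1]
      by (simp only: minus_minus sum_distrib_left mult_minus_right)
    also have "\<dots> = (\<Sum>j<n. \<Sum>u | u \<in> ?U (Suc m) n \<and> length u - 1 = j.
        y_const (?c / of_nat (length u)) * y_power (Suc m) (parity u))"
    proof (intro sum.cong refl)
      fix j
      show "{u. u \<in> lists X \<and> length u = Suc j \<and> Suc m * weight u = n}
          = {u. u \<in> ?U (Suc m) n \<and> length u - 1 = j}"
      proof (rule Collect_cong)
        fix u
        show "(u \<in> lists X \<and> length u = Suc j \<and> Suc m * weight u = n)
            = (u \<in> ?U (Suc m) n \<and> length u - 1 = j)"
          using n by (cases u) auto
      qed
    next
      fix j u assume "u \<in> {u. u \<in> ?U (Suc m) n \<and> length u - 1 = j}"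
      then have len: "length u = Suc j" using n by (cases u) auto
      have "y_const ?c * y_const (1 / of_nat (Suc j)) = y_const (?c / of_nat (length u))"
        unfolding len y_const_simps(4)[symmetric] by simp
      then show "y_const ?c * (y_const (1 / of_nat (Suc j)) * y_power (Suc m) (parity u))
          = y_const (?c / of_nat (length u)) * y_power (Suc m) (parity u)"
        by (simp only: mult.assoc[symmetric])
    qed
    also have "\<dots> = (\<Sum>u\<in>?U (Suc m) n. y_const (?c / of_nat (length u)) * y_power (Suc m) (parity u))"
    proof (rule sum.group)
      show "finite (?U (Suc m) n)" using finite_words_scaled[of "Suc m" n] by simp
      show "(\<lambda>u. length u - 1) ` ?U (Suc m) n \<subseteq> {..<n}"
      proof (rule image_subsetI)
        fix u assume u: "u \<in> ?U (Suc m) n"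
        have "length u \<le> weight u" using u by (intro length_le_weight) auto
        also have "\<dots> \<le> Suc m * weight u" by simp
        also have "\<dots> = n" using u by simp
        finally show "length u - 1 \<in> {..<n}" using n by auto
      qed
    qed simp
    finally show "fps_nth (?F m) n = (\<Sum>u\<in>?U (Suc m) n.
      y_const (of_nat (totient (Suc m)) / (of_nat (Suc m) * of_nat (length u)))
        * y_power (Suc m) (parity u))" by (simp only: divide_divide_eq_left)
  qed
  have vanish: "fps_nth (?F m) n = 0" if "m \<ge> n" for m n
  proof (cases "n = 0")
    case True
    then show ?thesis
      by (simp add: series_const_def series_log_nth[OF const0] del: of_nat_Suc)
  next
    case False
    have "?U (Suc m) n = {}"
    proof (rule ccontr)
      assume "?U (Suc m) n \<noteq> {}"
      then obtain u where u: "Suc m * weight u = n" by blast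
      then have "weight u \<ge> 1" using False by (cases "weight u") auto
      then have "Suc m \<le> n" using u by (metis mult.right_neutral mult_le_mono2)
      then show False using that by simp
    qed
    moreover have "n \<ge> 1" using False by simp
    ultimately show ?thesis by (simp only: nth sum.empty)
  qed
  have "trace_series = Abs_fps (\<lambda>n. \<Sum>m<n. fps_nth (?F m) n)"
  proof (rule fps_ext)
    fix n
    show "fps_nth trace_series n = fps_nth (Abs_fps (\<lambda>n. \<Sum>m<n. fps_nth (?F m) n)) n"
    proof (cases "n = 0")
      case True
      then show ?thesis by (simp add: trace_series_def)
    next
      case False
      then have n: "n \<ge> 1" by simp
      have "{1..n} = Suc ` {..<n}" by (auto simp: image_iff Bex_def) (metis Suc_le_D Suc_le_eq)
      then show ?thesis
        unfolding trace_series_nth[OF n] sum_over_fixed_rotations[OF n] fps_nth_Abs_fps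
          nth[OF n] by (simp add: sum.reindex)
    qed
  qed
  then show ?thesis using fps_sums_nth[of ?F, OF vanish] by simp
qed

end


section \<open>Linear algebra of noncommutative polynomials\<close>

text \<open>
  The scalar multiplication of the free algebra, as it appears in its module structure.
\<close>

definition scale :: "'k::field \<Rightarrow> ('a list \<Rightarrow>\<^sub>0 'k) \<Rightarrow> ('a list \<Rightarrow>\<^sub>0 'k)" where
  "scale c p = Poly_Mapping.single [] c * p"

lemma lookup_scale [simp]: "Poly_Mapping.lookup (scale c p) w = c * Poly_Mapping.lookup p w"
proof -
  have "scale c p = Poly_Mapping.map ((*) c) p"
    by (simp add: scale_def mult_map_scale_conv_mult zero_list_def)
  then show ?thesis by (simp add: map.rep_eq when_def)
qed

interpretation fa: Vector_Spaces.vector_space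
  "scale :: 'k::field \<Rightarrow> ('a list \<Rightarrow>\<^sub>0 'k) \<Rightarrow> ('a list \<Rightarrow>\<^sub>0 'k)"
  by unfold_locales (auto intro!: poly_mapping_eqI simp: lookup_add algebra_simps)

lemma scale_mult_left: "scale c p * q = scale c (p * q)"
  by (simp add: scale_def mult.assoc)

lemma sum_words: "(\<Sum>w\<in>Poly_Mapping.keys p. scale (Poly_Mapping.lookup p w) (word w)) = p"
  by (rule poly_mapping_eqI)
    (simp add: lookup_sum word_def lookup_single when_def in_keys_iff if_distrib[of "(*) _"]
      cong: if_cong)

lemma scale_word: "scale c (word w) = Poly_Mapping.single w c"
  by (rule poly_mapping_eqI) (simp add: word_def lookup_single when_def)

lemma lookup_word: "Poly_Mapping.lookup (word w) v = (if v = w then 1 else 0)"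
  by (simp add: word_def lookup_single when_def)

lemma word_mult: "word u * word v = word (u @ v)"
  by (simp add: word_def mult_single plus_list_def)

lemma word_Nil: "word [] = 1"
  by (simp add: word_def flip: zero_list_def)

lemma scale_mult_right: "p * scale c q = scale c (p * q)"
proof -
  have comm: "p * Poly_Mapping.single [] c = Poly_Mapping.single [] c * p" for p :: "'a list \<Rightarrow>\<^sub>0 'b"
  proof -
    have "scale d (word w) * Poly_Mapping.single [] c
        = Poly_Mapping.single [] c * scale d (word w)" for d and w :: "'a list"
      by (simp add: scale_word mult_single plus_list_def mult.commute)
    then show ?thesis
      by (subst (1 2) sum_words[of p, symmetric]) (simp add: sum_distrib_left sum_distrib_right)
  qed
  show ?thesis
    unfolding scale_def by (simp add: comm flip: mult.assoc)
qed

definition lin_ext :: "('a list \<Rightarrow> ('b list \<Rightarrow>\<^sub>0 'k::field)) \<Rightarrow> ('a list \<Rightarrow>\<^sub>0 'k) \<Rightarrow> ('b list \<Rightarrow>\<^sub>0 'k)" where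
  "lin_ext g p = (\<Sum>w\<in>Poly_Mapping.keys p. scale (Poly_Mapping.lookup p w) (g w))"

lemma lin_ext_superset:
  assumes "finite S" "Poly_Mapping.keys p \<subseteq> S"
  shows "lin_ext g p = (\<Sum>w\<in>S. scale (Poly_Mapping.lookup p w) (g w))"
  unfolding lin_ext_def using assms
  by (intro sum.mono_neutral_left) (auto simp: in_keys_iff)

lemma lin_ext_0 [simp]: "lin_ext g 0 = 0"
  by (simp add: lin_ext_def)

lemma lin_ext_add: "lin_ext g (p + q) = lin_ext g p + lin_ext g q"
proof -
  let ?S = "Poly_Mapping.keys p \<union> Poly_Mapping.keys q"
  have "lin_ext g r = (\<Sum>w\<in>?S. scale (Poly_Mapping.lookup r w) (g w))"
    if "r \<in> {p, q, p + q}" for r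
    using that Poly_Mapping.keys_add[of p q] by (intro lin_ext_superset) auto
  then show ?thesis
    by (simp add: lookup_add fa.scale_left_distrib sum.distrib)
qed

lemma keys_scale: "Poly_Mapping.keys (scale c p) \<subseteq> Poly_Mapping.keys p"
  by (auto simp: in_keys_iff)

lemma lin_ext_scale: "lin_ext g (scale c p) = scale c (lin_ext g p)"
  unfolding lin_ext_superset[OF finite_keys keys_scale] lin_ext_def[of g p]
  by (simp add: fa.scale_sum_right)

lemma lin_ext_word [simp]: "lin_ext g (word w) = g w"
  by (simp add: lin_ext_def word_def)

lemma lin_ext_sum: "lin_ext g (sum f S) = (\<Sum>x\<in>S. lin_ext g (f x))"
  by (induction S rule: infinite_finite_induct) (simp_all add: lin_ext_add)

lemma lin_ext_diff: "lin_ext g (p - q) = lin_ext g p - lin_ext g q"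
proof -
  have "lin_ext g (p - q) + lin_ext g q = lin_ext g p"
    by (simp flip: lin_ext_add)
  then show ?thesis by (simp add: algebra_simps)
qed

lemma lin_ext_lin_ext: "lin_ext g (lin_ext h p) = lin_ext (\<lambda>w. lin_ext g (h w)) p"
  by (simp add: lin_ext_def[of h] lin_ext_def[of "\<lambda>w. lin_ext g (h w)"] lin_ext_sum lin_ext_scale)

lemma lin_ext_cong:
  "(\<And>w. w \<in> Poly_Mapping.keys p \<Longrightarrow> g w = h w) \<Longrightarrow> lin_ext g p = lin_ext h p"
  by (simp add: lin_ext_def)

lemma lin_ext_word_id: "lin_ext word p = p"
  by (simp add: lin_ext_def sum_words)

definition supported :: "'a list set \<Rightarrow> ('a list \<Rightarrow>\<^sub>0 'k::field) set" where
  "supported S = {p. Poly_Mapping.keys p \<subseteq> S}"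

lemma subspace_supported: "fa.subspace (supported S :: ('a list \<Rightarrow>\<^sub>0 'k::field) set)"
proof (rule fa.subspaceI)
  fix p q :: "'a list \<Rightarrow>\<^sub>0 'k" 
  assume "p \<in> supported S" "q \<in> supported S"
  then show "p + q \<in> supported S"
    using Poly_Mapping.keys_add[of p q] by (auto simp: supported_def)
next
  fix c and p :: "'a list \<Rightarrow>\<^sub>0 'k" 
  assume "p \<in> supported S"
  then show "scale c p \<in> supported S"
    using keys_scale[of c p] by (auto simp: supported_def)
qed (simp add: supported_def)

lemma supported_eq_span: "supported S = fa.span (word ` S)"
proof
  show "supported S \<subseteq> fa.span (word ` S)"
  proof
    fix p assume "p \<in> supported S"
    then have "(\<Sum>w\<in>Poly_Mapping.keys p. scale (Poly_Mapping.lookup p w) (word w)) \<in> fa.span (word ` S)"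
      by (intro fa.span_sum fa.span_scale fa.span_base) (auto simp: supported_def)
    then show "p \<in> fa.span (word ` S)" by (simp add: sum_words)
  qed
  show "fa.span (word ` S) \<subseteq> supported S"
    by (intro fa.span_minimal subspace_supported) (auto simp: supported_def word_def)
qed

lemma word_in_supported: "word w \<in> supported S \<longleftrightarrow> w \<in> S"
  by (simp add: supported_def word_def)

lemma lin_ext_in_span:
  assumes "p \<in> supported S"
  shows "lin_ext g p \<in> fa.span (g ` S)"
  unfolding lin_ext_def using assms
  by (intro fa.span_sum fa.span_scale fa.span_base) (auto simp: supported_def)

lemma lin_ext_image_supported: "lin_ext g ` supported S = fa.span (g ` S)"
proof
  show "lin_ext g ` supported S \<subseteq> fa.span (g ` S)" using lin_ext_in_span by blast
  have "fa.subspace (lin_ext g ` supported S)"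
  proof (rule fa.subspaceI)
    show "0 \<in> lin_ext g ` supported S"
      using fa.subspace_0[OF subspace_supported] by (rule rev_image_eqI) simp
    fix x y assume "x \<in> lin_ext g ` supported S" "y \<in> lin_ext g ` supported S"
    then show "x + y \<in> lin_ext g ` supported S"
      by (auto simp: fa.subspace_add[OF subspace_supported] simp flip: lin_ext_add intro!: imageI)
  next
    fix c x assume "x \<in> lin_ext g ` supported S"
    then show "scale c x \<in> lin_ext g ` supported S"
      by (auto simp: fa.subspace_scale[OF subspace_supported] simp flip: lin_ext_scale intro!: imageI)
  qed
  moreover have "g ` S \<subseteq> lin_ext g ` supported S"
    by (auto intro!: rev_image_eqI[of "word _"] simp: word_in_supported)
  ultimately show "fa.span (g ` S) \<subseteq> lin_ext g ` supported S"
    by (rule fa.span_minimal[rotated])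
qed

definition part :: "('a list \<Rightarrow> bool) \<Rightarrow> ('a list \<Rightarrow>\<^sub>0 'k::field) \<Rightarrow> ('a list \<Rightarrow>\<^sub>0 'k)" where
  "part P = lin_ext (\<lambda>w. if P w then word w else 0)"

lemma lookup_part: "Poly_Mapping.lookup (part P p) w = (if P w then Poly_Mapping.lookup p w else 0)"
proof -
  have "Poly_Mapping.lookup (part P p) w
      = (\<Sum>v\<in>Poly_Mapping.keys p. if v = w \<and> P w then Poly_Mapping.lookup p v else 0)"
    by (auto simp: part_def lin_ext_def lookup_sum lookup_word intro!: sum.cong)
  also have "\<dots> = (if P w then Poly_Mapping.lookup p w else 0)"
    by (cases "P w") (simp_all add: in_keys_iff)
  finally show ?thesis .
qed

lemma keys_part: "Poly_Mapping.keys (part P p) = {w \<in> Poly_Mapping.keys p. P w}"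
  by (auto simp: in_keys_iff lookup_part split: if_splits)

text \<open>
  Let \<open>T\<close> be the linear extension of \<open>g\<close>. With dual coordinates \<open>c\<^sub>b\<close> for a basis \<open>B\<close> of its image, idempotence says
  \<open>1 = c\<^sub>b (T b) = \<Sum>\<^sub>w b\<^sub>w c\<^sub>b (g w)\<close>; summing over \<open>b\<close> gives the trace, because
  \<open>g w = \<Sum>\<^sub>b c\<^sub>b (g w) b\<close>.
\<close>

lemma dim_image_idempotent_eq_trace:
  assumes S: "finite S"
    and into: "\<And>w. w \<in> S \<Longrightarrow> g w \<in> supported S"
    and idem: "\<And>w. w \<in> S \<Longrightarrow> lin_ext g (g w) = g w"
  shows "of_nat (fa.dim (fa.span (g ` S))) = (\<Sum>w\<in>S. Poly_Mapping.lookup (g w) w)"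
proof -
  let ?U = "fa.span (g ` S)"
  obtain B where B: "B \<subseteq> ?U" "fa.independent B" "?U \<subseteq> fa.span B" "card B = fa.dim ?U"
    by (rule fa.basis_exists)
  have finB: "finite B"
    using fa.independent_span_bound[of "g ` S" B] S B by auto
  define r where "r b w = fa.representation B (g w) b" for b w
  have gw: "g w \<in> fa.span B" if "w \<in> S" for w
    using B(3) fa.span_base[of "g w" "g ` S"] that by blast
  have expand: "g w = (\<Sum>b\<in>B. scale (r b w) b)" if "w \<in> S" for w
    unfolding r_def using fa.sum_representation_eq[OF B(2) gw[OF that] finB] by simp
  have one: "(\<Sum>w\<in>S. Poly_Mapping.lookup b w * r b w) = 1" if b: "b \<in> B" for b
  proof -
    have "b \<in> supported S"
    proof -
      have "?U \<subseteq> supported S"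
        by (rule fa.span_minimal) (use into subspace_supported in auto)
      then show ?thesis using b B(1) by blast
    qed
    obtain p where p: "p \<in> supported S" "b = lin_ext g p"
      using b B(1) unfolding lin_ext_image_supported[symmetric] by blast
    have "lin_ext g b = b"
      unfolding p(2) lin_ext_lin_ext using p(1) idem
      by (intro lin_ext_cong) (auto simp: supported_def)
    then have "b = (\<Sum>w\<in>S. scale (Poly_Mapping.lookup b w) (g w))"
      using lin_ext_superset[OF S, of b g] \<open>b \<in> supported S\<close> by (simp add: supported_def)
    then have "fa.representation B b = fa.representation B (\<Sum>w\<in>S. scale (Poly_Mapping.lookup b w) (g w))"
      by simp
    also have "\<dots> = (\<lambda>b'. \<Sum>w\<in>S. Poly_Mapping.lookup b w * r b' w)"
      using gw by (simp add: fa.representation_sum[OF B(2)] fa.span_scale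
          fa.representation_scale[OF B(2)] r_def)
    finally have "fa.representation B b b = (\<Sum>w\<in>S. Poly_Mapping.lookup b w * r b w)"
      by (rule fun_cong)
    then show ?thesis by (simp add: fa.representation_basis[OF B(2) b])
  qed
  have "(\<Sum>w\<in>S. Poly_Mapping.lookup (g w) w) = (\<Sum>w\<in>S. \<Sum>b\<in>B. r b w * Poly_Mapping.lookup b w)"
  proof (rule sum.cong[OF refl])
    fix w assume w: "w \<in> S"
    show "Poly_Mapping.lookup (g w) w = (\<Sum>b\<in>B. r b w * Poly_Mapping.lookup b w)"
      by (subst expand[OF w]) (simp add: lookup_sum)
  qed
  also have "\<dots> = (\<Sum>b\<in>B. \<Sum>w\<in>S. Poly_Mapping.lookup b w * r b w)"
    by (subst sum.swap) (simp add: mult.commute)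
  also have "\<dots> = of_nat (card B)" by (simp add: one)
  finally show ?thesis by (simp add: B(4))
qed


section \<open>Vector spaces embedded in noncommutative polynomials\<close>

definition linear_on :: "('k::field, 'm) module \<Rightarrow> ('m \<Rightarrow> ('a list \<Rightarrow>\<^sub>0 'k)) \<Rightarrow> bool" where
  "linear_on M F \<longleftrightarrow> \<zero>\<^bsub>M\<^esub> \<in> carrier M \<and> F \<zero>\<^bsub>M\<^esub> = 0 \<and>
     (\<forall>x\<in>carrier M. \<forall>y\<in>carrier M. x \<oplus>\<^bsub>M\<^esub> y \<in> carrier M \<and> F (x \<oplus>\<^bsub>M\<^esub> y) = F x + F y) \<and>
     (\<forall>c. \<forall>x\<in>carrier M. c \<odot>\<^bsub>M\<^esub> x \<in> carrier M \<and> F (c \<odot>\<^bsub>M\<^esub> x) = scale c (F x))"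

text \<open>
  A space that embeds linearly into noncommutative polynomials inherits the vector space axioms, spans,
  dimensions and direct sum decompositions from the ambient space. Every space in the proof, including
  the quotients whose elements are cosets, is handled through such an embedding.
\<close>

definition embeds :: "('k::field, 'm) module \<Rightarrow> ('m \<Rightarrow> ('a list \<Rightarrow>\<^sub>0 'k)) \<Rightarrow> bool" where
  "embeds M F \<longleftrightarrow> linear_on M F \<and> inj_on F (carrier M)"

lemma linear_onD:
  assumes "linear_on M F"
  shows "\<zero>\<^bsub>M\<^esub> \<in> carrier M" "F \<zero>\<^bsub>M\<^esub> = 0"
    "x \<in> carrier M \<Longrightarrow> y \<in> carrier M \<Longrightarrow> x \<oplus>\<^bsub>M\<^esub> y \<in> carrier M"
    "x \<in> carrier M \<Longrightarrow> y \<in> carrier M \<Longrightarrow> F (x \<oplus>\<^bsub>M\<^esub> y) = F x + F y"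
    "x \<in> carrier M \<Longrightarrow> c \<odot>\<^bsub>M\<^esub> x \<in> carrier M"
    "x \<in> carrier M \<Longrightarrow> F (c \<odot>\<^bsub>M\<^esub> x) = scale c (F x)"
  using assms by (auto simp: linear_on_def)

lemma embedsD:
  assumes "embeds M F"
  shows "\<zero>\<^bsub>M\<^esub> \<in> carrier M" "F \<zero>\<^bsub>M\<^esub> = 0"
    "x \<in> carrier M \<Longrightarrow> y \<in> carrier M \<Longrightarrow> x \<oplus>\<^bsub>M\<^esub> y \<in> carrier M"
    "x \<in> carrier M \<Longrightarrow> y \<in> carrier M \<Longrightarrow> F (x \<oplus>\<^bsub>M\<^esub> y) = F x + F y"
    "x \<in> carrier M \<Longrightarrow> c \<odot>\<^bsub>M\<^esub> x \<in> carrier M"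
    "x \<in> carrier M \<Longrightarrow> F (c \<odot>\<^bsub>M\<^esub> x) = scale c (F x)"
    "x \<in> carrier M \<Longrightarrow> y \<in> carrier M \<Longrightarrow> F x = F y \<Longrightarrow> x = y"
  using assms linear_onD[of M F] by (auto simp: embeds_def inj_on_def)

text \<open>
  Each axiom is an equation, and it may be checked after applying the injective map \<open>F\<close>.
\<close>

lemma embeds_vectorspace:
  fixes M :: "('k::field, 'm) module"
  assumes "embeds M F"
  shows "vectorspace class_ring M"
proof -
  note E = embedsD[OF assms]
  have eqI: "x = y" if "x \<in> carrier M" "y \<in> carrier M" "F x = F y" for x y
    using E(7) that by blast
  show ?thesis
  proof (rule vs_criteria)
    show "field (class_ring :: 'k ring)" by (rule class_field)
    show "\<forall>v\<in>carrier M. \<exists>neg_v\<in>carrier M. v \<oplus>\<^bsub>M\<^esub> neg_v = \<zero>\<^bsub>M\<^esub>"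
    proof
      fix v assume v: "v \<in> carrier M"
      then show "\<exists>neg_v\<in>carrier M. v \<oplus>\<^bsub>M\<^esub> neg_v = \<zero>\<^bsub>M\<^esub>"
        by (intro bexI[of _ "(- 1) \<odot>\<^bsub>M\<^esub> v"] eqI) (simp_all add: E(1-6))
    qed
  qed (auto intro!: eqI simp: E(1-6) fa.scale_left_distrib fa.scale_right_distrib add_ac)
qed

lemma embeds_finsum:
  assumes M: "embeds M F" and A: "f \<in> A \<rightarrow> carrier M"
  shows "F (finsum M f A) = (\<Sum>x\<in>A. F (f x))"
proof -
  interpret M: vectorspace class_ring M by (rule embeds_vectorspace[OF M])
  show ?thesis using A
  proof (induction A rule: infinite_finite_induct)
    case (infinite A)
    then show ?case using embedsD(2)[OF M] by (simp add: finsum_def finprod_def)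
  next
    case empty
    then show ?case using embedsD(2)[OF M] by simp
  next
    case (insert x A)
    then show ?case by (subst M.finsum_insert) (auto simp: embedsD(4)[OF M] M.finsum_closed)
  qed
qed

lemma embeds_restrict:
  assumes M: "embeds M F" and W: "W \<subseteq> carrier M" and sub: "fa.subspace (F ` W)"
  shows "embeds (M\<lparr>carrier := W\<rparr>) F" "VectorSpace.subspace class_ring W M"
proof -
  interpret M: vectorspace class_ring M by (rule embeds_vectorspace[OF M])
  note E = embedsD[OF M]
  have mem: "x \<in> W" if x: "x \<in> carrier M" "F x \<in> F ` W" for x
    using x W E(7) by blast
  have zero: "\<zero>\<^bsub>M\<^esub> \<in> W"
    by (rule mem) (use E(1,2) fa.subspace_0[OF sub] in auto)
  have add: "x \<oplus>\<^bsub>M\<^esub> y \<in> W" if "x \<in> W" "y \<in> W" for x y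
    by (rule mem) (use that W E(3,4) fa.subspace_add[OF sub, of "F x" "F y"] in \<open>auto simp: subset_iff\<close>)
  have smult: "c \<odot>\<^bsub>M\<^esub> x \<in> W" if "x \<in> W" for c x
    by (rule mem) (use that W E(5,6) fa.subspace_scale[OF sub, of "F x"] in \<open>auto simp: subset_iff\<close>)
  show "embeds (M\<lparr>carrier := W\<rparr>) F"
    using zero add smult W E(2,4,6,7)
    by (auto simp: embeds_def linear_on_def inj_on_def subset_iff)
  have "submodule class_ring W M"
    using zero add smult W by (intro submodule.intro M.module_axioms) auto
  then show "VectorSpace.subspace class_ring W M"
    by (intro subspace.intro M.vectorspace_axioms)
qed

lemma embeds_lincomb:
  assumes M: "embeds M F" and A: "A \<subseteq> carrier M"
  shows "F (LinearCombinations.module.lincomb M a A) = (\<Sum>x\<in>A. scale (a x) (F x))"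
proof -
  interpret M: vectorspace class_ring M by (rule embeds_vectorspace[OF M])
  have "F (M.lincomb a A) = (\<Sum>x\<in>A. F (a x \<odot>\<^bsub>M\<^esub> x))"
    unfolding M.lincomb_def by (rule embeds_finsum[OF M]) (use A embedsD(5)[OF M] in auto)
  then show ?thesis using A embedsD(6)[OF M] by (simp add: subset_iff)
qed

lemma embeds_span:
  assumes M: "embeds M F" and S: "S \<subseteq> carrier M"
  shows "F ` LinearCombinations.module.span class_ring M S = fa.span (F ` S)"
    and "LinearCombinations.module.span class_ring M S \<subseteq> carrier M"
proof -
  interpret M: vectorspace class_ring M by (rule embeds_vectorspace[OF M])
  note E = embedsD[OF M]
  show sub: "M.span S \<subseteq> carrier M" using S by (rule M.span_is_subset2)
  interpret sp: submodule class_ring "M.span S" M using S by (rule M.span_is_submodule)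
  show "F ` M.span S = fa.span (F ` S)"
  proof
    show "F ` M.span S \<subseteq> fa.span (F ` S)"
    proof clarify
      fix x assume "x \<in> M.span S"
      then obtain a A where A: "finite A" "A \<subseteq> S" "x = M.lincomb a A"
        by (auto simp: M.span_def)
      have "F x = (\<Sum>x\<in>A. scale (a x) (F x))"
        unfolding A(3) by (rule embeds_lincomb[OF M]) (use A S in auto)
      then show "F x \<in> fa.span (F ` S)"
        using A(2) by (simp only:) (intro fa.span_sum fa.span_scale fa.span_base, blast)
    qed
    have "fa.subspace (F ` M.span S)"
    proof (rule fa.subspaceI)
      show "0 \<in> F ` M.span S" using E(2) sp.zero_closed by (metis imageI)
    next
      fix x y assume "x \<in> F ` M.span S" "y \<in> F ` M.span S"
      then obtain u v where uv: "u \<in> M.span S" "v \<in> M.span S" "x = F u" "y = F v" by blast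
      then have "x + y = F (u \<oplus>\<^bsub>M\<^esub> v)" using sub E(4) by (simp add: subset_iff)
      then show "x + y \<in> F ` M.span S" using uv sp.m_closed by blast
    next
      fix c x assume "x \<in> F ` M.span S"
      then obtain u where u: "u \<in> M.span S" "x = F u" by blast
      then have "scale c x = F (c \<odot>\<^bsub>M\<^esub> u)" using sub E(6) by (simp add: subset_iff)
      then show "scale c x \<in> F ` M.span S" using u sp.smult_closed by auto
    qed
    then show "fa.span (F ` S) \<subseteq> F ` M.span S"
      using M.in_own_span[OF S] by (intro fa.span_minimal image_mono)
  qed
qed

lemma embeds_dim:
  assumes M: "embeds M F" and T: "finite T" "F ` carrier M \<subseteq> fa.span T"
  shows "vectorspace.fin_dim class_ring M"
    and "vectorspace.dim class_ring M = fa.dim (F ` carrier M)"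
proof -
  interpret M: vectorspace class_ring M by (rule embeds_vectorspace[OF M])
  note E = embedsD[OF M]
  obtain B where B: "B \<subseteq> F ` carrier M" "fa.independent B" "F ` carrier M \<subseteq> fa.span B"
    "card B = fa.dim (F ` carrier M)" by (rule fa.basis_exists)
  have finB: "finite B" using fa.independent_span_bound[OF T(1) B(2)] T(2) B(1) by auto
  from B(1) obtain A where A: "A \<subseteq> carrier M" "inj_on F A" "B = F ` A"
    by (auto simp: subset_image_inj)
  have finA: "finite A" using finB A by (simp add: finite_image_iff)
  have gen: "M.span A = carrier M"
  proof
    show "M.span A \<subseteq> carrier M" by (rule embeds_span(2)[OF M A(1)])
    show "carrier M \<subseteq> M.span A"
    proof
      fix x assume x: "x \<in> carrier M"
      then have "F x \<in> F ` M.span A"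
        unfolding embeds_span(1)[OF M A(1)] using B(3) A(3) by blast
      then obtain y where "y \<in> M.span A" "F x = F y" by blast
      then show "x \<in> M.span A" using E(7)[OF x, of y] embeds_span(2)[OF M A(1)] by auto
    qed
  qed
  have "M.lin_indpt A"
  proof (rule M.finite_lin_indpt2[OF finA A(1)])
    fix a assume "M.lincomb a A = \<zero>\<^bsub>M\<^esub>"
    then have "(\<Sum>x\<in>A. scale (a x) (F x)) = 0"
      using embeds_lincomb[OF M A(1), of a] E(2) by simp
    moreover have "(\<Sum>b\<in>F ` A. scale (a (the_inv_into A F b)) b) = (\<Sum>x\<in>A. scale (a x) (F x))"
      by (subst sum.reindex[OF A(2)]) (simp add: the_inv_into_f_f[OF A(2)])
    ultimately have zero: "(\<Sum>b\<in>B. scale (a (the_inv_into A F b)) b) = 0"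
      unfolding A(3) by metis
    show "\<forall>v\<in>A. a v = \<zero>\<^bsub>class_ring\<^esub>"
    proof
      fix v assume v: "v \<in> A"
      have "a (the_inv_into A F (F v)) = 0"
        by (rule fa.independentD[OF B(2) finB subset_refl zero]) (use v A(3) in blast)
      then show "a v = \<zero>\<^bsub>class_ring\<^esub>"
        by (simp add: the_inv_into_f_f[OF A(2) v])
    qed
  qed
  then have "M.basis A" using gen A(1) by (simp add: M.basis_def)
  then show "M.dim = fa.dim (F ` carrier M)"
    using M.dim_basis[OF finA] A B(4) by (simp add: card_image)
  show "M.fin_dim" using finA A(1) gen by (auto simp: M.fin_dim_def)
qed

text \<open>
  The grading of the ambient space by a degree function on words induces a direct sum decomposition on
  every subspace that is stable under the projections to the homogeneous parts.
\<close>

lemma embeds_direct_sum: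
  assumes M: "embeds M F"
    and W: "\<And>d. d \<in> bidegrees \<Longrightarrow> W (fst d) (snd d) \<subseteq> carrier M"
    and FW: "\<And>d. d \<in> bidegrees \<Longrightarrow>
      F ` W (fst d) (snd d) = {p \<in> F ` carrier M. \<forall>w\<in>Poly_Mapping.keys p. deg w = d}"
    and deg: "\<And>p w. p \<in> F ` carrier M \<Longrightarrow> w \<in> Poly_Mapping.keys p \<Longrightarrow> deg w \<in> bidegrees"
    and part: "\<And>p d. p \<in> F ` carrier M \<Longrightarrow> part (\<lambda>w. deg w = d) p \<in> F ` carrier M"
  shows "is_direct_sum M W"
  unfolding is_direct_sum_def
proof (intro ballI)
  fix x assume x: "x \<in> carrier M"
  note E = embedsD[OF M]
  interpret M: vectorspace class_ring M by (rule embeds_vectorspace[OF M])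
  let ?p = "F x" and ?part = "\<lambda>d. part (\<lambda>w. deg w = d)"
  let ?good = "\<lambda>f. f \<in> (\<Pi>\<^sub>E d \<in> bidegrees. W (fst d) (snd d)) \<and>
        finite {d \<in> bidegrees. f d \<noteq> \<zero>\<^bsub>M\<^esub>} \<and>
        x = finsum M f {d \<in> bidegrees. f d \<noteq> \<zero>\<^bsub>M\<^esub>}"
  have sum_iff: "F (finsum M f {d \<in> bidegrees. f d \<noteq> \<zero>\<^bsub>M\<^esub>})
      = (\<Sum>d | d \<in> bidegrees \<and> f d \<noteq> \<zero>\<^bsub>M\<^esub>. F (f d))"
    if "f \<in> (\<Pi>\<^sub>E d \<in> bidegrees. W (fst d) (snd d))" for f
    by (rule embeds_finsum[OF M]) (use that W in blast)
  have part_of: "F (f d) = ?part d ?p" if f: "?good f" and d: "d \<in> bidegrees" for f d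
  proof (rule poly_mapping_eqI)
    fix w
    let ?D = "{d \<in> bidegrees. f d \<noteq> \<zero>\<^bsub>M\<^esub>}"
    have off: "Poly_Mapping.lookup (F (f d)) w = 0" if "d \<in> bidegrees" "deg w \<noteq> d" for d
    proof -
      have "f d \<in> W (fst d) (snd d)" using f that(1) by blast
      then have "F (f d) \<in> F ` W (fst d) (snd d)" by blast
      then show ?thesis unfolding FW[OF that(1)] using that(2) by (auto simp: in_keys_iff)
    qed
    show "Poly_Mapping.lookup (F (f d)) w = Poly_Mapping.lookup (?part d ?p) w"
    proof (cases "deg w = d")
      case False
      then show ?thesis using off[OF d] by (simp add: lookup_part)
    next
      case True
      have fP: "f \<in> (\<Pi>\<^sub>E d \<in> bidegrees. W (fst d) (snd d))" and fin: "finite ?D"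
        and fx: "x = finsum M f ?D" using f by blast+
      have "?p = (\<Sum>d\<in>?D. F (f d))"
        unfolding sum_iff[OF fP, symmetric] using fx by (rule arg_cong)
      then have "Poly_Mapping.lookup ?p w = (\<Sum>d\<in>?D. Poly_Mapping.lookup (F (f d)) w)"
        by (simp add: lookup_sum)
      also have "\<dots> = (\<Sum>d'\<in>{d}. Poly_Mapping.lookup (F (f d')) w)"
        by (rule sum.mono_neutral_cong) (use fin d True off E(2) in auto)
      finally show ?thesis using True by (simp add: lookup_part)
    qed
  qed
  have "\<exists>y. y \<in> W (fst d) (snd d) \<and> F y = ?part d ?p" if d: "d \<in> bidegrees" for d
  proof -
    have "?part d ?p \<in> F ` W (fst d) (snd d)"
      unfolding FW[OF d] using part[of ?p d] x by (auto simp: keys_part)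
    then show ?thesis by force
  qed
  then obtain y where y: "\<And>d. d \<in> bidegrees \<Longrightarrow> y d \<in> W (fst d) (snd d) \<and> F (y d) = ?part d ?p"
    by metis
  define f where "f = restrict y bidegrees"
  let ?D = "{d \<in> bidegrees. f d \<noteq> \<zero>\<^bsub>M\<^esub>}"
  have fPi: "f \<in> (\<Pi>\<^sub>E d \<in> bidegrees. W (fst d) (snd d))" using y by (auto simp: f_def)
  have fd: "f d = \<zero>\<^bsub>M\<^esub> \<longleftrightarrow> ?part d ?p = 0" if "d \<in> bidegrees" for d
  proof -
    have "f d \<in> carrier M" "F (f d) = ?part d ?p"
      using y[OF that] W[OF that] that by (auto simp: f_def)
    then show ?thesis using E(7)[of "f d" "\<zero>\<^bsub>M\<^esub>"] E(1,2) by auto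
  qed
  have D: "?D = deg ` Poly_Mapping.keys ?p"
  proof -
    have "?part d ?p \<noteq> 0 \<longleftrightarrow> d \<in> deg ` Poly_Mapping.keys ?p" for d
      by (simp flip: keys_eq_empty add: keys_part) blast
    then show ?thesis using fd deg x by blast
  qed
  have "F x = F (finsum M f ?D)"
  proof (rule poly_mapping_eqI)
    fix w
    have "Poly_Mapping.lookup (F (finsum M f ?D)) w
        = (\<Sum>d\<in>?D. Poly_Mapping.lookup (F (f d)) w)"
      unfolding sum_iff[OF fPi] by (simp add: lookup_sum)
    also have "\<dots> = (\<Sum>d\<in>?D. if deg w = d then Poly_Mapping.lookup ?p w else 0)"
      using y by (intro sum.cong refl) (simp add: f_def lookup_part)
    also have "\<dots> = Poly_Mapping.lookup ?p w"
      unfolding D by (auto simp: in_keys_iff)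
    finally show "Poly_Mapping.lookup (F x) w = Poly_Mapping.lookup (F (finsum M f ?D)) w" by simp
  qed
  then have "x = finsum M f ?D"
    by (rule E(7)[rotated 2]) (use x fPi W in \<open>blast intro!: M.finsum_closed\<close>)+
  then have good: "?good f" using fPi D by simp
  moreover have "g = f" if g: "?good g" for g
  proof
    fix d
    show "g d = f d"
    proof (cases "d \<in> bidegrees")
      case True
      have "g d \<in> W (fst d) (snd d)" "f d \<in> W (fst d) (snd d)" using g good True by blast+
      then have "g d \<in> carrier M" "f d \<in> carrier M" using W[OF True] by auto
      then show ?thesis by (rule E(7)) (simp only: part_of[OF g True] part_of[OF good True])
    next
      case False
      then show ?thesis using g good PiE_arb by metis
    qed
  qed
  ultimately show "\<exists>!f. ?good f" by blast
qed


section \<open>Quotients\<close>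

text \<open>
  Modulo the kernel of \<open>f\<close>, cosets are fibers of \<open>f\<close>; this makes the operations of the quotient computable and
  shows that \<open>f\<close> induces an embedding of it.
\<close>

lemma coset_eq_fiber:
  assumes M: "vectorspace class_ring M" and f: "linear_on M f"
    and N: "N = {x \<in> carrier M. f x = 0}" and x: "x \<in> carrier M"
  shows "N +>\<^bsub>M\<^esub> x = {y \<in> carrier M. f y = f x}"
proof -
  interpret M: vectorspace class_ring M by fact
  note L = linear_onD[OF f]
  show ?thesis
  proof (intro equalityI subsetI)
    fix y assume "y \<in> N +>\<^bsub>M\<^esub> x"
    then show "y \<in> {y \<in> carrier M. f y = f x}"
      using x by (auto simp: a_r_coset_def' N L(3,4))
  next
    fix y assume y: "y \<in> {y \<in> carrier M. f y = f x}"
    define n where "n = y \<oplus>\<^bsub>M\<^esub> ((- 1) \<odot>\<^bsub>M\<^esub> x)"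
    have "n \<in> N" using x y by (simp add: n_def N L)
    moreover have "n \<oplus>\<^bsub>M\<^esub> x = y"
    proof -
      have "(- 1) \<odot>\<^bsub>M\<^esub> x = \<ominus>\<^bsub>M\<^esub> x"
        using M.smult_minus_1[OF x] by (simp add: class_ring_simps)
      then show ?thesis using x y by (simp add: n_def M.a_assoc M.l_neg)
    qed
    ultimately show "y \<in> N +>\<^bsub>M\<^esub> x" by (auto simp: a_r_coset_def')
  qed
qed

definition on_coset :: "('m \<Rightarrow> 'b) \<Rightarrow> 'm set \<Rightarrow> 'b" where
  "on_coset f C = the_elem (f ` C)"

context
  fixes M :: "('k::field, 'm) module" and f :: "'m \<Rightarrow> ('a list \<Rightarrow>\<^sub>0 'k)" and N :: "'m set"
  assumes M: "vectorspace class_ring M" and f: "linear_on M f"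
    and N: "N = {x \<in> carrier M. f x = 0}"
begin

interpretation M: vectorspace class_ring M by (rule M)

lemma carrier_quotient: "carrier (quotient M N) = (\<lambda>x. N +>\<^bsub>M\<^esub> x) ` carrier M"
  by (auto simp: quotient_def ring.defs FactRing_def A_RCOSETS_def' a_r_coset_def')

lemma on_coset: "x \<in> carrier M \<Longrightarrow> on_coset f (N +>\<^bsub>M\<^esub> x) = f x"
proof -
  assume x: "x \<in> carrier M"
  then have "f ` (N +>\<^bsub>M\<^esub> x) = {f x}"
    unfolding coset_eq_fiber[OF M f N x] by auto
  then show ?thesis by (simp add: on_coset_def)
qed

lemma coset_eqI:
  "x \<in> carrier M \<Longrightarrow> y \<in> carrier M \<Longrightarrow> f x = f y \<Longrightarrow> N +>\<^bsub>M\<^esub> x = N +>\<^bsub>M\<^esub> y"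
  by (simp add: coset_eq_fiber[OF M f N])

lemma coset_self: "x \<in> carrier M \<Longrightarrow> x \<in> N +>\<^bsub>M\<^esub> x"
  by (simp add: coset_eq_fiber[OF M f N])

lemma quotient_add:
  assumes "x \<in> carrier M" "y \<in> carrier M"
  shows "(N +>\<^bsub>M\<^esub> x) \<oplus>\<^bsub>quotient M N\<^esub> (N +>\<^bsub>M\<^esub> y) = N +>\<^bsub>M\<^esub> (x \<oplus>\<^bsub>M\<^esub> y)"
proof -
  note L = linear_onD[OF f]
  have "(N +>\<^bsub>M\<^esub> x) \<oplus>\<^bsub>quotient M N\<^esub> (N +>\<^bsub>M\<^esub> y)
      = {u \<oplus>\<^bsub>M\<^esub> v | u v. u \<in> N +>\<^bsub>M\<^esub> x \<and> v \<in> N +>\<^bsub>M\<^esub> y}"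
    by (auto simp: quotient_def ring.defs FactRing_def set_add_def')
  also have "\<dots> = N +>\<^bsub>M\<^esub> (x \<oplus>\<^bsub>M\<^esub> y)"
  proof (intro equalityI subsetI)
    fix z assume "z \<in> {u \<oplus>\<^bsub>M\<^esub> v | u v. u \<in> N +>\<^bsub>M\<^esub> x \<and> v \<in> N +>\<^bsub>M\<^esub> y}"
    then show "z \<in> N +>\<^bsub>M\<^esub> (x \<oplus>\<^bsub>M\<^esub> y)"
      using assms by (auto simp: coset_eq_fiber[OF M f N] L)
  next
    fix z assume "z \<in> N +>\<^bsub>M\<^esub> (x \<oplus>\<^bsub>M\<^esub> y)"
    then obtain n where n: "n \<in> N" "z = n \<oplus>\<^bsub>M\<^esub> (x \<oplus>\<^bsub>M\<^esub> y)" by (auto simp: a_r_coset_def')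
    then have "z = (n \<oplus>\<^bsub>M\<^esub> x) \<oplus>\<^bsub>M\<^esub> y" "n \<oplus>\<^bsub>M\<^esub> x \<in> N +>\<^bsub>M\<^esub> x"
      using assms by (auto simp: N M.a_assoc a_r_coset_def')
    then show "z \<in> {u \<oplus>\<^bsub>M\<^esub> v | u v. u \<in> N +>\<^bsub>M\<^esub> x \<and> v \<in> N +>\<^bsub>M\<^esub> y}"
      using coset_self[OF assms(2)] by blast
  qed
  finally show ?thesis .
qed

lemma quotient_smult:
  assumes "x \<in> carrier M"
  shows "c \<odot>\<^bsub>quotient M N\<^esub> (N +>\<^bsub>M\<^esub> x) = N +>\<^bsub>M\<^esub> (c \<odot>\<^bsub>M\<^esub> x)"
proof -
  note L = linear_onD[OF f]
  have "c \<odot>\<^bsub>quotient M N\<^esub> (N +>\<^bsub>M\<^esub> x) = (\<Union>u\<in>N +>\<^bsub>M\<^esub> x. N +>\<^bsub>M\<^esub> (c \<odot>\<^bsub>M\<^esub> u))"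
    by (simp add: quotient_def ring.defs module.defs)
  also have "N +>\<^bsub>M\<^esub> (c \<odot>\<^bsub>M\<^esub> u) = N +>\<^bsub>M\<^esub> (c \<odot>\<^bsub>M\<^esub> x)" if "u \<in> N +>\<^bsub>M\<^esub> x" for u
    by (rule coset_eqI) (use that assms in \<open>auto simp: coset_eq_fiber[OF M f N] L\<close>)
  then have "(\<Union>u\<in>N +>\<^bsub>M\<^esub> x. N +>\<^bsub>M\<^esub> (c \<odot>\<^bsub>M\<^esub> u)) = N +>\<^bsub>M\<^esub> (c \<odot>\<^bsub>M\<^esub> x)"
    using coset_self[OF assms] by blast
  finally show ?thesis .
qed

lemma quotient_mult:
  assumes "x \<in> carrier M" "y \<in> carrier M"
    and mult: "\<And>u v. u \<in> carrier M \<Longrightarrow> v \<in> carrier M \<Longrightarrow> u \<otimes>\<^bsub>M\<^esub> v \<in> carrier M"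
    and fmult: "\<And>u v. u \<in> carrier M \<Longrightarrow> v \<in> carrier M \<Longrightarrow> f (u \<otimes>\<^bsub>M\<^esub> v) = f u * f v"
  shows "(N +>\<^bsub>M\<^esub> x) \<otimes>\<^bsub>quotient M N\<^esub> (N +>\<^bsub>M\<^esub> y) = N +>\<^bsub>M\<^esub> (x \<otimes>\<^bsub>M\<^esub> y)"
proof -
  have "(N +>\<^bsub>M\<^esub> x) \<otimes>\<^bsub>quotient M N\<^esub> (N +>\<^bsub>M\<^esub> y)
      = (\<Union>u\<in>N +>\<^bsub>M\<^esub> x. \<Union>v\<in>N +>\<^bsub>M\<^esub> y. N +>\<^bsub>M\<^esub> (u \<otimes>\<^bsub>M\<^esub> v))"
    by (simp add: quotient_def ring.defs FactRing_def rcoset_mult_def)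
  also have "N +>\<^bsub>M\<^esub> (u \<otimes>\<^bsub>M\<^esub> v) = N +>\<^bsub>M\<^esub> (x \<otimes>\<^bsub>M\<^esub> y)"
    if "u \<in> N +>\<^bsub>M\<^esub> x" "v \<in> N +>\<^bsub>M\<^esub> y" for u v
    by (rule coset_eqI) (use that assms in \<open>auto simp: coset_eq_fiber[OF M f N]\<close>)
  then have "(\<Union>u\<in>N +>\<^bsub>M\<^esub> x. \<Union>v\<in>N +>\<^bsub>M\<^esub> y. N +>\<^bsub>M\<^esub> (u \<otimes>\<^bsub>M\<^esub> v)) = N +>\<^bsub>M\<^esub> (x \<otimes>\<^bsub>M\<^esub> y)"
    using coset_self assms(1,2) by blast
  finally show ?thesis .
qed

lemma quotient_embeds: "embeds (quotient M N) (on_coset f)"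
proof -
  note L = linear_onD[OF f]
  have zero: "\<zero>\<^bsub>quotient M N\<^esub> = N +>\<^bsub>M\<^esub> \<zero>\<^bsub>M\<^esub>"
    unfolding coset_eq_fiber[OF M f N L(1)]
    by (simp add: quotient_def ring.defs FactRing_def N L(2))
  have "linear_on (quotient M N) (on_coset f)"
    unfolding linear_on_def carrier_quotient zero
  proof (intro conjI ballI allI)
    show "N +>\<^bsub>M\<^esub> \<zero>\<^bsub>M\<^esub> \<in> (\<lambda>x. N +>\<^bsub>M\<^esub> x) ` carrier M" using L(1) by (rule imageI)
    show "on_coset f (N +>\<^bsub>M\<^esub> \<zero>\<^bsub>M\<^esub>) = 0" using on_coset[OF L(1)] L(2) by simp
  next
    fix C D assume "C \<in> (\<lambda>x. N +>\<^bsub>M\<^esub> x) ` carrier M" "D \<in> (\<lambda>x. N +>\<^bsub>M\<^esub> x) ` carrier M"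
    then obtain x y where xy: "x \<in> carrier M" "y \<in> carrier M"
      and C: "C = N +>\<^bsub>M\<^esub> x" and D: "D = N +>\<^bsub>M\<^esub> y" by blast
    show "C \<oplus>\<^bsub>quotient M N\<^esub> D \<in> (\<lambda>x. N +>\<^bsub>M\<^esub> x) ` carrier M"
      unfolding C D quotient_add[OF xy] using L(3)[OF xy] by (rule imageI)
    show "on_coset f (C \<oplus>\<^bsub>quotient M N\<^esub> D) = on_coset f C + on_coset f D"
      unfolding C D quotient_add[OF xy] by (simp only: on_coset xy L(3,4))
  next
    fix c C assume "C \<in> (\<lambda>x. N +>\<^bsub>M\<^esub> x) ` carrier M"
    then obtain x where x: "x \<in> carrier M" and C: "C = N +>\<^bsub>M\<^esub> x" by blast
    show "c \<odot>\<^bsub>quotient M N\<^esub> C \<in> (\<lambda>x. N +>\<^bsub>M\<^esub> x) ` carrier M"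
      unfolding C quotient_smult[OF x] using L(5)[OF x] by (rule imageI)
    show "on_coset f (c \<odot>\<^bsub>quotient M N\<^esub> C) = scale c (on_coset f C)"
      unfolding C quotient_smult[OF x] by (simp only: on_coset x L(5,6))
  qed
  moreover have "inj_on (on_coset f) (carrier (quotient M N))"
    unfolding carrier_quotient
  proof (rule inj_onI)
    fix C D assume "C \<in> (\<lambda>x. N +>\<^bsub>M\<^esub> x) ` carrier M" "D \<in> (\<lambda>x. N +>\<^bsub>M\<^esub> x) ` carrier M"
      and eq: "on_coset f C = on_coset f D"
    then obtain x y where xy: "x \<in> carrier M" "y \<in> carrier M"
      and C: "C = N +>\<^bsub>M\<^esub> x" and D: "D = N +>\<^bsub>M\<^esub> y" by blast
    show "C = D"
      using eq unfolding C D on_coset[OF xy(1)] on_coset[OF xy(2)] by (rule coset_eqI[OF xy])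
  qed
  ultimately show ?thesis by (simp add: embeds_def)
qed

end


section \<open>Cyclic averaging\<close>

lemma koszul_sign_0 [simp]: "koszul_sign 0 e = 1" "koszul_sign e 0 = 1"
  by (simp_all add: koszul_sign_def)

text \<open>
  The exponents agree modulo \<open>2\<close>: \<open>a (t + d) + t (d + a) = (a + t) d + 2 a t\<close>.
\<close>

lemma koszul_sign_cocycle:
  "koszul_sign a (t + d) * koszul_sign t (d + a) = (koszul_sign (a + t) d :: 'k::field)"
  by (cases a; cases t; cases d) (simp_all add: koszul_sign_def)

lemma supported_mult:
  assumes "p \<in> supported S" "q \<in> supported T" "\<And>u v. u \<in> S \<Longrightarrow> v \<in> T \<Longrightarrow> u @ v \<in> R"
  shows "p * q \<in> supported R"
  using assms Poly_Mapping.keys_mult[of p q] by (force simp: supported_def plus_list_def)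

lemma mult_expand:
  "p * q = (\<Sum>u\<in>Poly_Mapping.keys p. \<Sum>v\<in>Poly_Mapping.keys q.
     scale (Poly_Mapping.lookup p u * Poly_Mapping.lookup q v) (word (u @ v)))"
proof -
  have "p * q = (\<Sum>u\<in>Poly_Mapping.keys p. scale (Poly_Mapping.lookup p u) (word u)) *
      (\<Sum>v\<in>Poly_Mapping.keys q. scale (Poly_Mapping.lookup q v) (word v))"
    by (simp only: sum_words)
  also have "\<dots> = (\<Sum>u\<in>Poly_Mapping.keys p. \<Sum>v\<in>Poly_Mapping.keys q.
     scale (Poly_Mapping.lookup p u * Poly_Mapping.lookup q v) (word (u @ v)))"
    by (simp add: sum_product scale_mult_left scale_mult_right word_mult mult.commute)
  finally show ?thesis .
qed

lemma of_rat_koszul_sign: "of_rat (koszul_sign d e) = koszul_sign d e"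
  by (simp add: koszul_sign_def of_rat_minus)

context graded_alphabet
begin

abbreviation words_of :: "nat \<Rightarrow> bit \<Rightarrow> 'v list set" where
  "words_of n e \<equiv> {w \<in> lists X. weight w = n \<and> parity w = e}"

definition rotation :: "nat \<Rightarrow> 'v list \<Rightarrow> ('v list \<Rightarrow>\<^sub>0 'k::field)" where
  "rotation i w =
     scale (koszul_sign (parity (take i w)) (parity (drop i w))) (word (drop i w @ take i w))"

text \<open>
  Averaging over all rotations, with signs, projects onto the signed cyclic invariants; on words of positive
  length this needs division by the length and hence characteristic zero. The empty word is sent to \<open>0\<close>,
  because \<open>1 / 0 = 0\<close>.
\<close>

definition cyclic_mean :: "'v list \<Rightarrow> ('v list \<Rightarrow>\<^sub>0 'k::field)" where
  "cyclic_mean w = scale (1 / of_nat (length w)) (\<Sum>i=1..length w. rotation i w)"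

text \<open>
  Rotating by one letter permutes the rotations cyclically; the rotation by the whole length of the new
  word becomes the rotation by one letter of the old one.
\<close>

lemma cyclic_mean_Cons:
  "cyclic_mean (x # v) = scale (koszul_sign (par x) (parity v)) (cyclic_mean (v @ [x]) :: 'v list \<Rightarrow>\<^sub>0 'k::field)"
proof -
  let ?s = "koszul_sign (par x) (parity v) :: 'k::field"
  let ?r = "length (x # v)"
  have step: "scale ?s (rotation i (v @ [x])) = rotation (Suc i) (x # v)" if "i \<le> length v" for i
  proof -
    have "parity v = parity (take i v) + parity (drop i v)"
      by (metis append_take_drop_id map_append sum_list_append)
    moreover have "?s * koszul_sign (parity (take i v)) (parity (drop i v) + par x)
        = koszul_sign (par x + parity (take i v)) (parity (drop i v))"
      unfolding \<open>parity v = _\<close> by (rule koszul_sign_cocycle)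
    moreover have "rotation i (v @ [x]) = scale (koszul_sign (parity (take i v))
        (parity (drop i v) + par x)) (word (drop i v @ x # take i v) :: 'v list \<Rightarrow>\<^sub>0 'k)"
      using that by (simp add: rotation_def)
    moreover have "rotation (Suc i) (x # v) = scale (koszul_sign (par x + parity (take i v))
        (parity (drop i v))) (word (drop i v @ x # take i v) :: 'v list \<Rightarrow>\<^sub>0 'k)"
      by (simp add: rotation_def)
    ultimately show ?thesis by (simp only: fa.scale_scale)
  qed
  have last: "scale ?s (rotation ?r (v @ [x])) = rotation 1 (x # v)"
    by (simp add: rotation_def)
  have "{1..?r} = insert ?r {1..length v}" by auto
  then have "(\<Sum>i=1..?r. scale ?s (rotation i (v @ [x])))
      = rotation 1 (x # v) + (\<Sum>i=1..length v. rotation (Suc i) (x # v))"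
    by (simp add: last[simplified] step)
  also have "\<dots> = (\<Sum>i=1..?r. rotation i (x # v))"
  proof -
    have "(\<Sum>i=1..?r. rotation i (x # v))
        = rotation 1 (x # v) + (\<Sum>i=Suc 1..Suc (length v). rotation i (x # v) :: 'v list \<Rightarrow>\<^sub>0 'k)"
      unfolding length_Cons by (rule sum.atLeast_Suc_atMost) simp
    then show ?thesis by (simp only: sum.shift_bounds_cl_Suc_ivl)
  qed
  finally have eq: "scale ?s (\<Sum>i=1..?r. rotation i (v @ [x])) = (\<Sum>i=1..?r. rotation i (x # v))"
    by (simp only: fa.scale_sum_right)
  have len: "length (v @ [x]) = ?r" by simp
  show ?thesis
    unfolding cyclic_mean_def len eq[symmetric] by (rule fa.scale_left_commute)
qed

text \<open>
  Moving \<open>u\<close> past \<open>v\<close> one letter at a time; the cocycle identity multiplies the signs up to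
  \<open>(-1)\<close> to the product of the two sign degrees, so that the average annihilates all commutators of words.
\<close>

lemma cyclic_mean_append:
  "cyclic_mean (u @ v) = scale (koszul_sign (parity u) (parity v)) (cyclic_mean (v @ u) :: 'v list \<Rightarrow>\<^sub>0 'k::field)"
proof (induction u arbitrary: v)
  case Nil
  then show ?case by simp
next
  case (Cons x u)
  have "(cyclic_mean ((x # u) @ v) :: 'v list \<Rightarrow>\<^sub>0 'k)
      = scale (koszul_sign (par x) (parity u + parity v)) (cyclic_mean (u @ v @ [x]))"
    using cyclic_mean_Cons[of x "u @ v"] by simp
  also have "\<dots> = scale (koszul_sign (par x) (parity u + parity v)
      * koszul_sign (parity u) (parity v + par x)) (cyclic_mean ((v @ [x]) @ u))"
    using Cons.IH[of "v @ [x]"] by simp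
  also have "koszul_sign (par x) (parity u + parity v) * koszul_sign (parity u) (parity v + par x)
      = (koszul_sign (par x + parity u) (parity v) :: 'k)"
    by (rule koszul_sign_cocycle)
  finally show ?case by simp
qed

lemma lin_ext_cyclic_mean_rotation: "lin_ext cyclic_mean (rotation i w) = (cyclic_mean w :: 'v list \<Rightarrow>\<^sub>0 'k::field)"
  using cyclic_mean_append[of "take i w" "drop i w", where ?'k = 'k]
  by (simp add: rotation_def lin_ext_scale)

lemma cyclic_mean_idem:
  "lin_ext cyclic_mean (cyclic_mean w) = (cyclic_mean w :: 'v list \<Rightarrow>\<^sub>0 'k::field_char_0)"
proof (cases "w = []")
  case True
  then show ?thesis by (simp add: cyclic_mean_def)
next
  case False
  have "lin_ext cyclic_mean (scale (1 / of_nat (length w)) (\<Sum>i=1..length w. rotation i w))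
      = scale (1 / of_nat (length w)) (\<Sum>i=1..length w. cyclic_mean w :: 'v list \<Rightarrow>\<^sub>0 'k)"
    by (simp only: lin_ext_scale lin_ext_sum lin_ext_cyclic_mean_rotation)
  then have "lin_ext cyclic_mean (cyclic_mean w)
      = scale (1 / of_nat (length w)) (\<Sum>i=1..length w. cyclic_mean w :: 'v list \<Rightarrow>\<^sub>0 'k)"
    by (simp only: cyclic_mean_def[of w, symmetric])
  also have "\<dots> = cyclic_mean w"
    using False by (intro poly_mapping_eqI) (simp add: lookup_sum del: sum_constant, simp)
  finally show ?thesis .
qed

lemma rotation_supported: "rotation i w \<in> supported {v. weight v = weight w \<and> parity v = parity w \<and> set v = set w}"
proof -
  have "weight (drop i w @ take i w) = weight (take i w @ drop i w)"
    "parity (drop i w @ take i w) = parity (take i w @ drop i w)"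
    "set (drop i w @ take i w) = set (take i w @ drop i w)"
    unfolding map_append sum_list_append set_append by (auto simp: add.commute)
  then show ?thesis
    unfolding rotation_def
    by (intro fa.subspace_scale[OF subspace_supported]) (simp add: word_in_supported)
qed

lemma cyclic_mean_supported:
  "(cyclic_mean w :: 'v list \<Rightarrow>\<^sub>0 'k::field)
    \<in> supported {v. weight v = weight w \<and> parity v = parity w \<and> set v = set w}"
  unfolding cyclic_mean_def
  by (intro fa.subspace_scale[OF subspace_supported] fa.subspace_sum[OF subspace_supported]
      rotation_supported)

lemma part_cyclic_mean:
  "part (\<lambda>w. (weight w, parity w) = d) (lin_ext cyclic_mean p)
    = lin_ext cyclic_mean (part (\<lambda>w. (weight w, parity w) = d) p :: 'v list \<Rightarrow>\<^sub>0 'k::field)"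
proof -
  have "part (\<lambda>w. (weight w, parity w) = d) (cyclic_mean w :: 'v list \<Rightarrow>\<^sub>0 'k)
      = lin_ext cyclic_mean (if (weight w, parity w) = d then word w else 0)" for w
    using cyclic_mean_supported[of w]
    by (intro poly_mapping_eqI) (auto simp: lookup_part supported_def in_keys_iff subset_iff)
  then show ?thesis
    unfolding part_def lin_ext_lin_ext by (simp only:)
qed

lemma lookup_cyclic_mean_self: "Poly_Mapping.lookup (cyclic_mean w :: 'v list \<Rightarrow>\<^sub>0 'k::field) w = rotation_trace w"
proof -
  have "Poly_Mapping.lookup (\<Sum>i=1..length w. rotation i w :: 'v list \<Rightarrow>\<^sub>0 'k) w
      = (\<Sum>i=1..length w. if drop i w @ take i w = w
          then koszul_sign (parity (take i w)) (parity (drop i w)) else 0 :: 'k)"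
    unfolding lookup_sum
    by (intro sum.cong refl) (auto simp: rotation_def lookup_word)
  also have "\<dots> = (\<Sum>i\<in>fixed_rotations w. koszul_sign (parity (take i w)) (parity (drop i w)))"
    unfolding fixed_rotations_def by (rule sum.inter_filter[symmetric]) simp
  finally show ?thesis by (simp add: cyclic_mean_def rotation_trace_def)
qed

lemma of_rat_rotation_trace: "of_rat (rotation_trace w) = (rotation_trace w :: 'k::field_char_0)"
  by (simp add: rotation_trace_def of_rat_mult of_rat_divide of_rat_sum of_rat_koszul_sign)

text \<open>
  The dimension is the rank of an idempotent, hence its trace. The trace is a sum of rational numbers
  inside \<open>k\<close>, and in characteristic zero the equation descends to the rational numbers.
\<close>

lemma dim_cyclic_mean:
  "of_nat (fa.dim (fa.span (cyclic_mean ` words_of n e) :: ('v list \<Rightarrow>\<^sub>0 'k::field_char_0) set))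
    = (\<Sum>w\<in>words_of n e. rotation_trace w :: rat)"
proof -
  have fin: "finite (words_of n e)"
    by (rule finite_subset[OF _ finite_words[of n]]) auto
  have "of_nat (fa.dim (fa.span (cyclic_mean ` words_of n e) :: ('v list \<Rightarrow>\<^sub>0 'k) set))
      = (\<Sum>w\<in>words_of n e. Poly_Mapping.lookup (cyclic_mean w :: 'v list \<Rightarrow>\<^sub>0 'k) w)"
  proof (rule dim_image_idempotent_eq_trace[OF fin])
    fix w assume "w \<in> words_of n e"
    then show "(cyclic_mean w :: 'v list \<Rightarrow>\<^sub>0 'k) \<in> supported (words_of n e)"
      using cyclic_mean_supported[of w, where ?'k = 'k] by (force simp: supported_def)
  qed (rule cyclic_mean_idem)
  also have "\<dots> = of_rat (\<Sum>w\<in>words_of n e. rotation_trace w)"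
    by (simp add: lookup_cyclic_mean_self of_rat_sum of_rat_rotation_trace)
  finally show ?thesis
    unfolding of_rat_of_nat_eq[symmetric, where ?'a = 'k] by (simp only: of_rat_eq_iff)
qed

definition commutators :: "('v list \<Rightarrow>\<^sub>0 'k::field) set" where
  "commutators = {a * b - scale (koszul_sign d e) (b * a) | a b m d n e.
     a \<in> supported (words_of m d) \<and> b \<in> supported (words_of n e)}"

lemma rotation_difference_commutator:
  assumes w: "w \<in> lists X"
  shows "word w - rotation i w \<in> (commutators :: ('v list \<Rightarrow>\<^sub>0 'k::field) set)"
proof -
  have *: "word w = word (take i w) * (word (drop i w) :: 'v list \<Rightarrow>\<^sub>0 'k)"
    by (simp add: word_mult)
  have "take i w \<in> lists X" "drop i w \<in> lists X"
    using w by (auto simp: in_lists_conv_set dest: in_set_takeD in_set_dropD)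
  then show ?thesis
    unfolding commutators_def rotation_def *
    by (intro CollectI exI[of _ "word (take i w)"] exI[of _ "word (drop i w)"]
        exI[of _ "weight (take i w)"] exI[of _ "parity (take i w)"]
        exI[of _ "weight (drop i w)"] exI[of _ "parity (drop i w)"])
      (simp add: word_in_supported word_mult)
qed

text \<open>
  The average annihilates commutators by the previous lemmas. Conversely, each \<open>w\<close> minus its average is a
  combination of the commutators \<open>w\<close> minus a rotation of \<open>w\<close>, so that \<open>p = p - P p\<close> is a combination of
  commutators whenever the average \<open>P p\<close> vanishes. A commutator with the empty word is zero, which is why all of them have
  positive weight.
\<close>

lemma span_commutators_eq:
  "fa.span commutators = {p \<in> supported (lists X - {[]}).
     lin_ext cyclic_mean p = (0 :: 'v list \<Rightarrow>\<^sub>0 'k::field_char_0)}" (is "_ = ?K")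
proof
  have sub: "fa.subspace ?K"
    by (rule fa.subspaceI)
      (auto simp: lin_ext_add lin_ext_scale fa.subspace_0[OF subspace_supported]
        fa.subspace_add[OF subspace_supported] fa.subspace_scale[OF subspace_supported])
  show "fa.span commutators \<subseteq> ?K"
  proof (rule fa.span_minimal[OF _ sub], rule subsetI)
    fix c :: "'v list \<Rightarrow>\<^sub>0 'k" assume "c \<in> commutators"
    then obtain a b m d n e where c: "c = a * b - scale (koszul_sign d e) (b * a)"
      and a: "a \<in> supported (words_of m d)" and b: "b \<in> supported (words_of n e)"
      unfolding commutators_def by blast
    let ?c = "\<lambda>u v. word (u @ v) - scale (koszul_sign d e) (word (v @ u)) :: 'v list \<Rightarrow>\<^sub>0 'k"
    have "b * a = (\<Sum>u\<in>Poly_Mapping.keys a. \<Sum>v\<in>Poly_Mapping.keys b.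
        scale (Poly_Mapping.lookup a u * Poly_Mapping.lookup b v) (word (v @ u)))"
      by (subst mult_expand, subst sum.swap) (simp add: mult.commute)
    then have "c = (\<Sum>u\<in>Poly_Mapping.keys a. \<Sum>v\<in>Poly_Mapping.keys b.
        scale (Poly_Mapping.lookup a u * Poly_Mapping.lookup b v) (?c u v))"
      unfolding c by (simp add: mult_expand[of a b] fa.scale_right_diff_distrib fa.scale_sum_right
          sum_subtractf mult.left_commute mult.commute)
    moreover have "?c u v \<in> ?K" if u: "u \<in> words_of m d" and v: "v \<in> words_of n e" for u v
    proof (cases "u @ v = []")
      case True
      then show ?thesis using u v fa.subspace_0[OF sub] by simp
    next
      case False
      then have "?c u v \<in> supported (lists X - {[]})" using u v
        by (intro fa.subspace_diff[OF subspace_supported] fa.subspace_scale[OF subspace_supported])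
          (auto simp: word_in_supported)
      moreover have "lin_ext cyclic_mean (?c u v) = 0"
        using u v cyclic_mean_append[of u v, where ?'k = 'k]
        by (simp add: lin_ext_diff lin_ext_scale)
      ultimately show ?thesis by simp
    qed
    ultimately show "c \<in> ?K"
      using a b by (simp only:)
        (intro fa.subspace_sum[OF sub] fa.subspace_scale[OF sub]; unfold supported_def; blast)
  qed
  show "?K \<subseteq> fa.span commutators"
  proof
    fix p assume p: "p \<in> ?K"
    have word: "word w - cyclic_mean w \<in> fa.span (commutators :: ('v list \<Rightarrow>\<^sub>0 'k) set)"
      if w: "w \<in> lists X" "w \<noteq> []" for w
    proof -
      have "word w - cyclic_mean w
          = scale (1 / of_nat (length w)) (\<Sum>i=1..length w. word w - rotation i w :: 'v list \<Rightarrow>\<^sub>0 'k)"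
        using w by (intro poly_mapping_eqI)
          (simp add: cyclic_mean_def sum_subtractf lookup_minus lookup_sum right_diff_distrib
            del: sum_constant, simp)
      then show ?thesis
        using rotation_difference_commutator[OF w(1)]
        by (simp only:) (intro fa.span_scale fa.span_sum fa.span_base)
    qed
    have "p = lin_ext word p - lin_ext cyclic_mean p" using p by (simp add: lin_ext_word_id)
    also have "\<dots> = (\<Sum>w\<in>Poly_Mapping.keys p. scale (Poly_Mapping.lookup p w) (word w - cyclic_mean w))"
      by (simp add: lin_ext_def sum_subtractf fa.scale_right_diff_distrib)
    also have "\<dots> \<in> fa.span commutators"
      using p by (intro fa.span_sum fa.span_scale word) (auto simp: supported_def)
    finally show "p \<in> fa.span commutators" .
  qed
qed

end


section \<open>A homogeneous basis\<close>

abbreviation letters :: "'v set \<Rightarrow> 'v list set" where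
  "letters Y \<equiv> (\<lambda>x. [x]) ` Y"

text \<open>
  The coordinates of a vector with respect to the basis \<open>X\<close>, written as a combination of words of length one.
  The embedding is the inverse of the map \<open>S\<close> that evaluates such a combination in \<open>V\<close>.
\<close>

lemma basis_embedding:
  fixes V :: "('k::field, 'v) module"
  assumes V: "vectorspace class_ring V" and X: "X \<subseteq> carrier V"
    and li: "\<not> LinearCombinations.module.lin_dep class_ring V X"
    and gen: "LinearCombinations.module.span class_ring V X = carrier V"
  shows "\<exists>L. embeds V L \<and> (\<forall>x\<in>X. L x = word [x])"
proof -
  interpret V: vectorspace class_ring V by fact
  define P :: "('v list \<Rightarrow>\<^sub>0 'k) set" where "P = supported (letters X)"
  define S where "S p = V.lincomb (\<lambda>x. Poly_Mapping.lookup p [x]) {x. [x] \<in> Poly_Mapping.keys p}"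
    for p :: "'v list \<Rightarrow>\<^sub>0 'k"
  have fin: "finite {x. [x] \<in> Poly_Mapping.keys p}" for p :: "'v list \<Rightarrow>\<^sub>0 'k"
    by (rule finite_imageD[of "\<lambda>x. [x]"]) (auto intro: finite_subset[OF _ finite_keys[of p]] inj_onI)
  have smult0: "0 \<odot>\<^bsub>V\<^esub> x = \<zero>\<^bsub>V\<^esub>" if "x \<in> carrier V" for x
    using V.lmult_0[OF that] by simp
  have S: "S p = V.lincomb (\<lambda>x. Poly_Mapping.lookup p [x]) A"
    if A: "finite A" "A \<subseteq> X" "{x. [x] \<in> Poly_Mapping.keys p} \<subseteq> A" for A p
    unfolding S_def V.lincomb_def
    by (rule V.add.finprod_mono_neutral_cong_left)
      (use A X in \<open>auto simp: in_keys_iff subset_iff smult0 intro!: V.smult_closed\<close>)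
  have keysP: "{x. [x] \<in> Poly_Mapping.keys p} \<subseteq> X" if "p \<in> P" for p
    using that by (auto simp: P_def supported_def)
  have Sclosed: "S p \<in> carrier V" if "p \<in> P" for p
    unfolding S_def by (rule V.lincomb_closed) (use keysP[OF that] X in auto)
  have Sadd: "S (p + q) = S p \<oplus>\<^bsub>V\<^esub> S q" if p: "p \<in> P" and q: "q \<in> P" for p q
  proof -
    let ?A = "{x. [x] \<in> Poly_Mapping.keys p} \<union> {x. [x] \<in> Poly_Mapping.keys q}"
    have A: "finite ?A" "?A \<subseteq> X" using fin keysP p q by auto
    have pq: "S r = V.lincomb (\<lambda>x. Poly_Mapping.lookup r [x]) ?A" if "r \<in> {p, q, p + q}" for r
      using that Poly_Mapping.keys_add[of p q] by (intro S[OF A]) auto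
    have "V.lincomb (\<lambda>x. Poly_Mapping.lookup p [x] \<oplus>\<^bsub>class_ring\<^esub> Poly_Mapping.lookup q [x]) ?A
        = V.lincomb (\<lambda>x. Poly_Mapping.lookup p [x]) ?A
          \<oplus>\<^bsub>V\<^esub> V.lincomb (\<lambda>x. Poly_Mapping.lookup q [x]) ?A"
      using A X by (intro V.lincomb_sum) auto
    then show ?thesis using pq by (simp add: lookup_add)
  qed
  have Sscale: "S (scale c p) = c \<odot>\<^bsub>V\<^esub> S p" if p: "p \<in> P" for c p
  proof -
    let ?A = "{x. [x] \<in> Poly_Mapping.keys p}"
    have "S (scale c p) = V.lincomb (\<lambda>x. Poly_Mapping.lookup (scale c p) [x]) ?A"
      using keys_scale[of c p] by (intro S fin keysP[OF p]) auto
    also have "\<dots> = c \<odot>\<^bsub>V\<^esub> S p"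
      unfolding S_def using V.lincomb_smult[of ?A "\<lambda>x. Poly_Mapping.lookup p [x]" c] keysP[OF p] X
      by simp
    finally show ?thesis .
  qed
  have subP: "fa.subspace P" by (simp add: P_def subspace_supported)
  have "inj_on S P"
  proof (rule inj_onI)
    fix p q assume p: "p \<in> P" and q: "q \<in> P" and eq: "S p = S q"
    have r: "p - q \<in> P" using fa.subspace_diff[OF subP p q] .
    have "S (p - q) = S (p + scale (- 1) q)" by simp
    also have "\<dots> = S p \<oplus>\<^bsub>V\<^esub> ((- 1) \<odot>\<^bsub>V\<^esub> S q)"
      using Sadd[OF p fa.subspace_scale[OF subP q]] Sscale[OF q] by metis
    also have "\<dots> = \<zero>\<^bsub>V\<^esub>"
      unfolding eq using V.smult_minus_1[OF Sclosed[OF q]] Sclosed[OF q]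
      by (simp add: class_ring_simps V.r_neg)
    finally have zero: "V.lincomb (\<lambda>x. Poly_Mapping.lookup (p - q) [x])
        {x. [x] \<in> Poly_Mapping.keys (p - q)} = \<zero>\<^bsub>V\<^esub>" by (simp add: S_def)
    have "Poly_Mapping.keys (p - q) = {}"
    proof (rule ccontr)
      assume "Poly_Mapping.keys (p - q) \<noteq> {}"
      then obtain w where "w \<in> Poly_Mapping.keys (p - q)" by blast
      moreover from this obtain x where "w = [x]" using r by (auto simp: P_def supported_def)
      ultimately have "[x] \<in> Poly_Mapping.keys (p - q)" by simp
      then have "V.lin_dep X"
        using fin keysP[OF r] zero
        by (intro V.lin_dep_crit[of "{x. [x] \<in> Poly_Mapping.keys (p - q)}" X
              "\<lambda>x. Poly_Mapping.lookup (p - q) [x]" x]) (auto simp: in_keys_iff)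
      then show False using li by simp
    qed
    then show "p = q" by simp
  qed
  moreover have "S ` P = carrier V"
  proof
    show "S ` P \<subseteq> carrier V" using Sclosed by blast
    show "carrier V \<subseteq> S ` P"
    proof
      fix v assume "v \<in> carrier V"
      then obtain a A where A: "finite A" "A \<subseteq> X" "v = V.lincomb a A"
        unfolding gen[symmetric] V.span_def by auto
      define p where "p = (\<Sum>x\<in>A. scale (a x) (word [x]))"
      have look: "Poly_Mapping.lookup p [x] = (if x \<in> A then a x else 0)" for x
        using A(1) by (simp add: p_def lookup_sum lookup_word if_distrib[of "(*) _"] cong: if_cong)
      have "p \<in> P" unfolding p_def P_def
        by (intro fa.subspace_sum[OF subspace_supported] fa.subspace_scale[OF subspace_supported])
          (use A(2) in \<open>auto simp: word_in_supported\<close>)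
      moreover have "S p = v"
      proof -
        have "S p = V.lincomb (\<lambda>x. Poly_Mapping.lookup p [x]) A"
          by (rule S[OF A(1,2)]) (auto simp: in_keys_iff look split: if_splits)
        also have "\<dots> = V.lincomb a A"
          by (rule V.lincomb_cong) (use A X look in auto)
        finally show ?thesis using A(3) by simp
      qed
      ultimately show "v \<in> S ` P" by blast
    qed
  qed
  ultimately have bij: "bij_betw S P (carrier V)" by (simp add: bij_betw_def)
  define L where "L = the_inv_into P S"
  have LP: "L v \<in> P" "S (L v) = v" if "v \<in> carrier V" for v
    using bij that unfolding L_def bij_betw_def
    by (auto intro: the_inv_into_into f_the_inv_into_f)
  have LS: "L (S p) = p" if "p \<in> P" for p
    using bij that unfolding L_def bij_betw_def by (simp add: the_inv_into_f_f)
  have "embeds V L"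
    unfolding embeds_def linear_on_def inj_on_def
  proof (intro conjI ballI allI impI)
    have "S 0 = \<zero>\<^bsub>V\<^esub>" by (simp add: S_def V.lincomb_def)
    then show "L \<zero>\<^bsub>V\<^esub> = 0" using LS[OF fa.subspace_0[OF subP]] by simp
  next
    fix x y assume xy: "x \<in> carrier V" "y \<in> carrier V"
    have "S (L x + L y) = x \<oplus>\<^bsub>V\<^esub> y" using LP xy by (simp add: Sadd)
    then show "L (x \<oplus>\<^bsub>V\<^esub> y) = L x + L y"
      using LS[OF fa.subspace_add[OF subP LP(1) LP(1)]] xy by metis
    show "L x = L y \<Longrightarrow> x = y" using LP(2) xy by metis
  next
    fix c x assume x: "x \<in> carrier V"
    have "S (scale c (L x)) = c \<odot>\<^bsub>V\<^esub> x" using LP x by (simp add: Sscale)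
    then show "L (c \<odot>\<^bsub>V\<^esub> x) = scale c (L x)"
      using LS[OF fa.subspace_scale[OF subP LP(1)]] x by metis
  qed auto
  moreover have "L x = word [x]" if x: "x \<in> X" for x
  proof -
    have "S (word [x]) = V.lincomb (\<lambda>y. Poly_Mapping.lookup (word [x]) [y]) {x}"
      by (rule S) (use x in \<open>auto simp: word_def\<close>)
    also have "\<dots> = x"
      unfolding V.lincomb_def using x X V.smult_one[of x]
      by (simp add: lookup_word subset_iff)
    finally show ?thesis using LS[of "word [x]"] x by (simp add: P_def word_in_supported)
  qed
  ultimately show ?thesis by blast
qed

text \<open>
  Uniqueness of the decomposition into components makes the union of bases of the components
  linearly independent.
\<close>

lemma homogeneous_basis:
  fixes V :: "('k::field, 'v) module"
  assumes G: "fd_bigraded V G"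
  shows "\<exists>B. (\<forall>d\<in>bidegrees. finite (B d) \<and> B d \<subseteq> G (fst d) (snd d) \<and>
        card (B d) = vectorspace.dim class_ring (V\<lparr>carrier := G (fst d) (snd d)\<rparr>) \<and>
        LinearCombinations.module.span class_ring V (B d) = G (fst d) (snd d)) \<and>
      (\<forall>d\<in>bidegrees. \<forall>d'\<in>bidegrees. d \<noteq> d' \<longrightarrow> B d \<inter> B d' = {}) \<and>
      \<not> LinearCombinations.module.lin_dep class_ring V (\<Union>d\<in>bidegrees. B d) \<and>
      LinearCombinations.module.span class_ring V (\<Union>d\<in>bidegrees. B d) = carrier V"
proof -
  let ?G = "\<lambda>d. G (fst d) (snd d)"
  have V: "vectorspace class_ring V" using G by (simp add: fd_bigraded_def)
  interpret V: vectorspace class_ring V by (rule V)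
  have sub: "VectorSpace.subspace class_ring (?G d) V"
    and fd: "vectorspace.fin_dim class_ring (V\<lparr>carrier := ?G d\<rparr>)" if "d \<in> bidegrees" for d
    using G that by (auto simp: fd_bigraded_def bidegrees_def)
  have subm: "submodule class_ring (?G d) V" if "d \<in> bidegrees" for d
    using sub[OF that] by (simp add: subspace_def)
  have Gcar: "?G d \<subseteq> carrier V" if "d \<in> bidegrees" for d
    using subm[OF that] by (simp add: submodule_def)
  have zeroG: "\<zero>\<^bsub>V\<^esub> \<in> ?G d" if "d \<in> bidegrees" for d
    using subm[OF that] by (simp add: submodule_def)
  have "\<exists>B. finite B \<and> B \<subseteq> ?G d \<and> card B = vectorspace.dim class_ring (V\<lparr>carrier := ?G d\<rparr>) \<and>
      V.span B = ?G d \<and> \<not> V.lin_dep B" if d: "d \<in> bidegrees" for d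
  proof -
    interpret W: vectorspace class_ring "V\<lparr>carrier := ?G d\<rparr>"
      by (rule V.subspace_is_vs[OF sub[OF d]])
    obtain B where B: "finite B" "W.basis B" using W.finite_basis_exists[OF fd[OF d]] by blast
    then have "B \<subseteq> ?G d" "\<not> W.lin_dep B" "W.span B = ?G d" by (simp_all add: W.basis_def)
    moreover from this V.span_li_not_depend[OF this(1) subm[OF d]]
    have "\<not> V.lin_dep B" "V.span B = ?G d" by simp_all
    ultimately show ?thesis using B W.dim_basis[OF B] by auto
  qed
  then obtain B where B: "\<And>d. d \<in> bidegrees \<Longrightarrow> finite (B d) \<and> B d \<subseteq> ?G d \<and>
      card (B d) = vectorspace.dim class_ring (V\<lparr>carrier := ?G d\<rparr>) \<and>
      V.span (B d) = ?G d \<and> \<not> V.lin_dep (B d)"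
    by metis
  let ?X = "\<Union>d\<in>bidegrees. B d"
  have X: "?X \<subseteq> carrier V" using B Gcar by blast
  let ?fam = "\<lambda>f. f \<in> (\<Pi>\<^sub>E d \<in> bidegrees. ?G d) \<and> finite {d \<in> bidegrees. f d \<noteq> \<zero>\<^bsub>V\<^esub>}"
  have unique: "f d = g d" if "?fam f" "?fam g"
    "finsum V f {d \<in> bidegrees. f d \<noteq> \<zero>\<^bsub>V\<^esub>} = finsum V g {d \<in> bidegrees. g d \<noteq> \<zero>\<^bsub>V\<^esub>}" for f g d
  proof -
    have "finsum V f {d \<in> bidegrees. f d \<noteq> \<zero>\<^bsub>V\<^esub>} \<in> carrier V"
      by (rule V.finsum_closed) (use that(1) Gcar in blast)
    then have "\<exists>!h. h \<in> (\<Pi>\<^sub>E d \<in> bidegrees. ?G d) \<and> finite {d \<in> bidegrees. h d \<noteq> \<zero>\<^bsub>V\<^esub>} \<and>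
        finsum V f {d \<in> bidegrees. f d \<noteq> \<zero>\<^bsub>V\<^esub>} = finsum V h {d \<in> bidegrees. h d \<noteq> \<zero>\<^bsub>V\<^esub>}"
      using G unfolding fd_bigraded_def is_direct_sum_def by blast
    then have "f = g" using that by blast
    then show ?thesis by simp
  qed
  have zero_family: "f d = \<zero>\<^bsub>V\<^esub>" if f: "?fam f" and d: "d \<in> bidegrees"
    and D: "finite D" "D \<subseteq> bidegrees" "\<And>d. d \<in> bidegrees - D \<Longrightarrow> f d = \<zero>\<^bsub>V\<^esub>"
    and sum: "finsum V f D = \<zero>\<^bsub>V\<^esub>" for f d D
  proof -
    let ?z = "\<lambda>d\<in>bidegrees. \<zero>\<^bsub>V\<^esub>"
    have "finsum V f {d \<in> bidegrees. f d \<noteq> \<zero>\<^bsub>V\<^esub>} = finsum V f D"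
      by (rule V.add.finprod_mono_neutral_cong_left) (use f D Gcar in blast)+
    also have "\<dots> = finsum V ?z {d \<in> bidegrees. ?z d \<noteq> \<zero>\<^bsub>V\<^esub>}"
    proof -
      have "{d \<in> bidegrees. ?z d \<noteq> \<zero>\<^bsub>V\<^esub>} = {}" by auto
      then show ?thesis by (simp only: V.finsum_empty sum)
    qed
    finally have "f d = ?z d"
      by (rule unique[rotated 2]) (use f zeroG in auto)
    then show ?thesis using d by simp
  qed
  have disj: "B d \<inter> B d' = {}" if d: "d \<in> bidegrees" "d' \<in> bidegrees" "d \<noteq> d'" for d d'
  proof (rule ccontr)
    assume "B d \<inter> B d' \<noteq> {}"
    then obtain x where x: "x \<in> B d" "x \<in> B d'" by blast
    have xG: "x \<in> ?G d" "x \<in> ?G d'" using x B d by blast+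
    have xc: "x \<in> carrier V" using xG(1) Gcar[OF d(1)] by blast
    have nx: "\<ominus>\<^bsub>V\<^esub> x \<in> ?G d'"
      using submodule.smult_closed[OF subm[OF d(2)] _ xG(2), of "- 1"] V.smult_minus_1[OF xc]
      by (simp add: class_ring_simps)
    \<comment> \<open>a common element would give the nontrivial relation \<open>x + (-x) = 0\<close> between two components\<close>
    define f where "f c = (if c \<in> bidegrees then if c = d then x else if c = d' then \<ominus>\<^bsub>V\<^esub> x else \<zero>\<^bsub>V\<^esub>
      else undefined)" for c
    have "f d = \<zero>\<^bsub>V\<^esub>"
    proof (rule zero_family[of f d "{d, d'}"])
      have "f \<in> (\<Pi>\<^sub>E d \<in> bidegrees. ?G d)"
        using xG nx zeroG d by (auto simp: f_def PiE_def extensional_def)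
      moreover have "finite {c \<in> bidegrees. f c \<noteq> \<zero>\<^bsub>V\<^esub>}"
        by (rule finite_subset[of _ "{d, d'}"]) (auto simp: f_def)
      ultimately show "?fam f" by blast
      show "finsum V f {d, d'} = \<zero>\<^bsub>V\<^esub>"
        using d xc by (subst V.finsum_insert) (auto simp: f_def V.r_neg)
    qed (use d in \<open>auto simp: f_def\<close>)
    then have "x = \<zero>\<^bsub>V\<^esub>" using d by (simp add: f_def)
    then show False using V.vs_zero_lin_dep[of "B d"] B[OF d(1)] Gcar[OF d(1)] x(1) by blast
  qed
  have "\<not> V.lin_dep ?X"
  proof
    assume "V.lin_dep ?X"
    then obtain A a v where A: "finite A" "A \<subseteq> ?X" "V.lincomb a A = \<zero>\<^bsub>V\<^esub>" "v \<in> A" "a v \<noteq> 0"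
      by (auto simp: V.lin_dep_def)
    define f where "f d = (if d \<in> bidegrees then V.lincomb a (A \<inter> B d) else undefined)" for d
    define D where "D = {d \<in> bidegrees. A \<inter> B d \<noteq> {}}"
    have finD: "finite D"
    proof -
      have "\<forall>x\<in>A. \<exists>d\<in>bidegrees. x \<in> B d" using A(2) by blast
      then obtain h where h: "\<And>x. x \<in> A \<Longrightarrow> h x \<in> bidegrees \<and> x \<in> B (h x)" by metis
      have "D \<subseteq> h ` A"
      proof
        fix d assume "d \<in> D"
        then obtain x where "x \<in> A" "x \<in> B d" "d \<in> bidegrees" by (auto simp: D_def)
        then have "d = h x" using disj h by blast
        then show "d \<in> h ` A" using \<open>x \<in> A\<close> by blast
      qed
      then show ?thesis using A(1) finite_surj by blast
    qed
    have fG: "f d \<in> ?G d" if "d \<in> bidegrees" for d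
    proof -
      have "V.lincomb a (A \<inter> B d) \<in> V.span (B d)"
        using A(1) by (auto simp: V.span_def)
      then show ?thesis using B[OF that] that by (simp add: f_def)
    qed
    have f0: "f d = \<zero>\<^bsub>V\<^esub>" if "d \<in> bidegrees - D" for d
      using that by (simp add: f_def D_def V.lincomb_def)
    have fam: "?fam f"
    proof
      show "f \<in> (\<Pi>\<^sub>E d \<in> bidegrees. ?G d)" using fG by (auto simp: PiE_def extensional_def f_def)
      show "finite {d \<in> bidegrees. f d \<noteq> \<zero>\<^bsub>V\<^esub>}"
        by (rule finite_subset[OF _ finD]) (use f0 in blast)
    qed
    have disjnt: "pairwise (\<lambda>d d'. disjnt (A \<inter> B d) (A \<inter> B d')) D"
      by (rule pairwiseI) (use disj in \<open>unfold D_def disjnt_def, blast\<close>)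
    have "finsum V f D = finsum V (\<lambda>d. finsum V (\<lambda>x. a x \<odot>\<^bsub>V\<^esub> x) (A \<inter> B d)) D"
      using A(2) X by (intro V.finsum_cong') (auto simp: f_def D_def V.lincomb_def intro!: V.finsum_closed V.smult_closed)
    also have "\<dots>
        = finsum V (\<lambda>x. a x \<odot>\<^bsub>V\<^esub> x) (\<Union>d\<in>D. A \<inter> B d)"
      by (rule V.add.finprod_UN_disjoint[symmetric])
        (use finD A(1,2) X disjnt in \<open>auto intro!: V.smult_closed\<close>)
    also have "(\<Union>d\<in>D. A \<inter> B d) = A" using A(2) unfolding D_def by blast
    finally have "finsum V f D = \<zero>\<^bsub>V\<^esub>" using A(3) by (simp add: V.lincomb_def)
    then have z: "f d = \<zero>\<^bsub>V\<^esub>" if "d \<in> bidegrees" for d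
      using zero_family[OF fam that finD] f0 by (auto simp: D_def)
    obtain d where d: "d \<in> bidegrees" "v \<in> B d" using A(2,4) by blast
    have "V.lincomb a (A \<inter> B d) = \<zero>\<^bsub>V\<^esub>" using z[OF d(1)] d(1) by (simp add: f_def)
    then have "V.lin_dep (B d)"
      using A d by (intro V.lin_dep_crit[of "A \<inter> B d" "B d" a v]) auto
    then show False using B[OF d(1)] by blast
  qed
  moreover have "V.span ?X = carrier V"
  proof
    show "V.span ?X \<subseteq> carrier V" by (rule V.span_is_subset2[OF X])
    interpret sp: submodule class_ring "V.span ?X" V by (rule V.span_is_submodule[OF X])
    show "carrier V \<subseteq> V.span ?X"
    proof
      fix x assume "x \<in> carrier V"
      then obtain f where f: "?fam f" "x = finsum V f {d \<in> bidegrees. f d \<noteq> \<zero>\<^bsub>V\<^esub>}"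
        using G unfolding fd_bigraded_def is_direct_sum_def by blast
      have "f d \<in> V.span ?X" if "d \<in> bidegrees" for d
      proof -
        have "f d \<in> V.span (B d)" using f(1) that B[OF that] by auto
        then show ?thesis using V.span_is_monotone[of "B d" ?X] that by blast
      qed
      moreover have "finsum V f D \<in> V.span ?X" if "finite D" "f \<in> D \<rightarrow> V.span ?X" for D
        using that
      proof (induction D)
        case (insert d D)
        then show ?case using \<open>V.span ?X \<subseteq> carrier V\<close>
          by (subst V.finsum_insert) (auto intro!: sp.m_closed)
      qed simp
      ultimately show "x \<in> V.span ?X" using f by blast
    qed
  qed
  ultimately show ?thesis
    by (intro exI[of _ B] conjI ballI impI) (simp_all add: B disj)
qed


section \<open>The tensor algebra in coordinates\<close>

lemma supported_UN_span: "fa.span (\<Union>i\<in>I. supported (S i)) = supported (\<Union>i\<in>I. S i)"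
proof
  show "fa.span (\<Union>i\<in>I. supported (S i)) \<subseteq> supported (\<Union>i\<in>I. S i)"
    by (rule fa.span_minimal[OF _ subspace_supported]) (auto simp: supported_def)
  show "supported (\<Union>i\<in>I. S i) \<subseteq> fa.span (\<Union>i\<in>I. supported (S i))"
    unfolding supported_eq_span[of "\<Union>i\<in>I. S i"]
    by (rule fa.span_mono) (auto simp: word_in_supported)
qed

lemma supported_mono: "S \<subseteq> S' \<Longrightarrow> p \<in> supported S \<Longrightarrow> p \<in> supported S'"
  by (auto simp: supported_def)

lemma lin_ext_mult:
  assumes "\<And>u v. g (u @ v) = g u * g v"
  shows "lin_ext g (p * q) = lin_ext g p * lin_ext g q"
proof -
  have "lin_ext g (p * q) = (\<Sum>u\<in>Poly_Mapping.keys p. \<Sum>v\<in>Poly_Mapping.keys q.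
      scale (Poly_Mapping.lookup p u * Poly_Mapping.lookup q v) (g (u @ v)))"
    by (subst mult_expand) (simp add: lin_ext_sum lin_ext_scale)
  also have "\<dots> = lin_ext g p * lin_ext g q"
    unfolding lin_ext_def[of g p] lin_ext_def[of g q]
    by (simp add: sum_product assms scale_mult_left scale_mult_right mult.commute)
  finally show ?thesis .
qed

lemma embeds_minus:
  assumes M: "embeds M F" and xy: "x \<in> carrier M" "y \<in> carrier M"
  shows "x \<ominus>\<^bsub>M\<^esub> y \<in> carrier M" "F (x \<ominus>\<^bsub>M\<^esub> y) = F x - F y"
proof -
  interpret M: vectorspace class_ring M by (rule embeds_vectorspace[OF M])
  show "x \<ominus>\<^bsub>M\<^esub> y \<in> carrier M" using xy by (rule M.minus_closed)
  have "F (x \<ominus>\<^bsub>M\<^esub> y) + F y = F ((x \<ominus>\<^bsub>M\<^esub> y) \<oplus>\<^bsub>M\<^esub> y)"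
    using xy by (simp add: embedsD(4)[OF M])
  also have "(x \<ominus>\<^bsub>M\<^esub> y) \<oplus>\<^bsub>M\<^esub> y = x"
    using xy by (simp add: M.minus_eq M.a_assoc M.l_neg)
  finally show "F (x \<ominus>\<^bsub>M\<^esub> y) = F x - F y" by (simp add: algebra_simps)
qed

lemma carrier_free_algebra: "carrier (free_algebra Y) = supported (lists Y)"
  by (auto simp: free_algebra_def supported_def in_lists_conv_set subset_iff)

lemma free_algebra_ops:
  "mult (free_algebra Y) = (*)" "add (free_algebra Y) = (+)" "zero (free_algebra Y) = 0"
  "one (free_algebra Y) = 1" "smult (free_algebra Y) = scale"
  by (auto simp: free_algebra_def scale_def fun_eq_iff)

lemma free_algebra_embeds: "embeds (free_algebra Y) (\<lambda>p. p)"
  unfolding embeds_def linear_on_def carrier_free_algebra free_algebra_ops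
  by (auto intro: fa.subspace_0 fa.subspace_add fa.subspace_scale subspace_supported)

lemma free_algebra_mult_closed:
  "p \<in> supported (lists Y) \<Longrightarrow> q \<in> supported (lists Y) \<Longrightarrow> p * q \<in> supported (lists Y)"
  by (rule supported_mult) auto

lemma ring_free_algebra: "ring (free_algebra Y)"
proof -
  interpret vectorspace class_ring "free_algebra Y"
    by (rule embeds_vectorspace[OF free_algebra_embeds])
  have "1 \<in> supported (lists Y)" by (simp add: word_in_supported flip: word_Nil)
  then show ?thesis
    using abelian_group_axioms
    by (intro ringI) (auto intro!: monoidI
      simp: carrier_free_algebra free_algebra_ops free_algebra_mult_closed algebra_simps)
qed

text \<open>
  The setting of all that follows: a basis \<open>X\<close> of \<open>V\<close> whose letters carry a weight and a sign degree, such
  that the letters of a given bidegree span the component of \<open>V\<close> in that bidegree.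
\<close>

locale tensor_coordinates = graded_alphabet X wt par
  for X :: "'v set" and wt :: "'v \<Rightarrow> nat" and par :: "'v \<Rightarrow> bit" +
  fixes V :: "('k::field_char_0, 'v) module" and G :: "nat \<Rightarrow> bit \<Rightarrow> 'v set"
    and L :: "'v \<Rightarrow> ('v list \<Rightarrow>\<^sub>0 'k)"
  assumes X: "X \<subseteq> carrier V"
    and L: "embeds V L"
    and L_letter: "x \<in> X \<Longrightarrow> L x = word [x]"
    and span_X: "LinearCombinations.module.span class_ring V X = carrier V"
    and span_component: "1 \<le> q \<Longrightarrow>
      LinearCombinations.module.span class_ring V {x \<in> X. wt x = q \<and> par x = e} = G q e"
begin

interpretation V: vectorspace class_ring V by (rule embeds_vectorspace[OF L])

abbreviation free :: "('k, 'v list \<Rightarrow>\<^sub>0 'k) module" where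
  "free \<equiv> free_algebra (carrier V)"

interpretation free: ring free by (rule ring_free_algebra)

interpretation free_vs: vectorspace class_ring free
  by (rule embeds_vectorspace[OF free_algebra_embeds])

lemma L_span:
  assumes "Y \<subseteq> X"
  shows "L ` LinearCombinations.module.span class_ring V Y = supported (letters Y)"
proof -
  have "L ` Y = word ` letters Y" using assms L_letter by (force simp: image_iff)
  then show ?thesis
    using embeds_span(1)[OF L, of Y] assms X by (simp add: supported_eq_span)
qed

lemma L_carrier: "L ` carrier V = supported (letters X)"
  using L_span[of X] by (simp add: span_X)

lemma L_component: "1 \<le> q \<Longrightarrow> L ` G q e = supported (letters {x \<in> X. wt x = q \<and> par x = e})"
  using L_span[of "{x \<in> X. wt x = q \<and> par x = e}"] by (simp add: span_component)

lemma component_carrier: "1 \<le> q \<Longrightarrow> G q e \<subseteq> carrier V"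
  using embeds_span(2)[OF L, of "{x \<in> X. wt x = q \<and> par x = e}"] X
  by (auto simp: span_component)

text \<open>
  The expansion of a formal product of vectors into words over the basis. The kernel of its linear extension
  is the tensor ideal, which makes that extension a normal form for elements of \<open>T(V)\<close>.
\<close>

definition expand :: "'v list \<Rightarrow> ('v list \<Rightarrow>\<^sub>0 'k)" where
  "expand w = prod_list (map L w)"

definition normal_form :: "('v list \<Rightarrow>\<^sub>0 'k) \<Rightarrow> ('v list \<Rightarrow>\<^sub>0 'k)" where
  "normal_form = lin_ext expand"

lemma expand_append: "expand (u @ v) = expand u * expand v"
  by (simp add: expand_def)

lemma normal_form_mult: "normal_form (p * q) = normal_form p * normal_form q"
  unfolding normal_form_def by (rule lin_ext_mult) (rule expand_append)

lemma normal_form_add: "normal_form (p + q) = normal_form p + normal_form q"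
  by (simp add: normal_form_def lin_ext_add)

lemma normal_form_diff: "normal_form (p - q) = normal_form p - normal_form q"
  by (simp add: normal_form_def lin_ext_diff)

lemma normal_form_scale: "normal_form (scale c p) = scale c (normal_form p)"
  by (simp add: normal_form_def lin_ext_scale)

lemma normal_form_word: "normal_form (word w) = expand w"
  by (simp add: normal_form_def)

lemma expand_letters: "w \<in> lists X \<Longrightarrow> expand w = word w"
  by (induction w) (auto simp: expand_def L_letter word_mult word_Nil)

lemma normal_form_id: "p \<in> supported (lists X) \<Longrightarrow> normal_form p = p"
proof -
  assume "p \<in> supported (lists X)"
  then have "lin_ext expand p = lin_ext word p"
    by (intro lin_ext_cong expand_letters) (auto simp: supported_def)
  then show ?thesis by (simp add: normal_form_def lin_ext_word_id)
qed

lemma L_supported: "v \<in> carrier V \<Longrightarrow> L v \<in> supported (lists X)"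
proof -
  assume "v \<in> carrier V"
  then have "L v \<in> supported (letters X)" using L_carrier by blast
  then show ?thesis by (force simp: supported_def)
qed

lemma expand_supported: "w \<in> lists (carrier V) \<Longrightarrow> expand w \<in> supported (lists X)"
proof (induction w)
  case Nil
  then show ?case by (simp add: expand_def word_in_supported flip: word_Nil)
next
  case (Cons v w)
  then show ?case
    by (simp add: expand_def free_algebra_mult_closed L_supported)
qed

lemma normal_form_supported: "p \<in> supported (lists (carrier V)) \<Longrightarrow> normal_form p \<in> supported (lists X)"
  unfolding normal_form_def lin_ext_def
  by (intro fa.subspace_sum[OF subspace_supported] fa.subspace_scale[OF subspace_supported]
      expand_supported) (auto simp: supported_def)

lemma supported_free: "p \<in> supported (lists X) \<Longrightarrow> p \<in> supported (lists (carrier V))"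
  using X by (force simp: supported_def)

lemma normal_form_linear: "linear_on free normal_form"
proof -
  have "embeds free (\<lambda>p. p)" by (rule free_algebra_embeds)
  from embedsD(1,3,5)[OF this] show ?thesis
    by (simp add: linear_on_def free_algebra_ops normal_form_add normal_form_scale)
      (simp add: normal_form_def)
qed

text \<open>
  The kernel of the normal form is an ideal containing the relations. Conversely, modulo the relations
  every vector is the combination of basis letters given by its coordinates, hence every word, by
  induction on its length, is congruent to its expansion.
\<close>

lemma tensor_ideal_eq: "tensor_ideal V = {p \<in> carrier free. normal_form p = 0}" (is "_ = ?K")
proof
  have carr: "carrier free = supported (lists (carrier V))" by (rule carrier_free_algebra)
  have word_carr: "word w \<in> carrier free" if "w \<in> lists (carrier V)" for w
    using that by (simp add: carr word_in_supported)
  have "additive_subgroup ?K free"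
  proof (rule additive_subgroup.intro, rule group.subgroupI[OF free.a_group])
    show "?K \<subseteq> carrier (add_monoid free)" by auto
    show "?K \<noteq> {}" using linear_onD(1,2)[OF normal_form_linear] by auto
    fix a assume a: "a \<in> ?K"
    have inv: "inv\<^bsub>add_monoid free\<^esub> a = - a"
    proof -
      have "- a \<in> carrier free"
        using a fa.subspace_neg[OF subspace_supported] by (auto simp: carr)
      then have "\<ominus>\<^bsub>free\<^esub> a = - a"
        using a by (intro free.minus_equality) (auto simp: free_algebra_ops)
      then show ?thesis by (simp add: a_inv_def)
    qed
    show "inv\<^bsub>add_monoid free\<^esub> a \<in> ?K"
      unfolding inv using a fa.subspace_neg[OF subspace_supported] normal_form_diff[of 0 a]
      by (auto simp: carr normal_form_def)
    fix b assume b: "b \<in> ?K"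
    show "a \<otimes>\<^bsub>add_monoid free\<^esub> b \<in> ?K"
      using a b linear_onD(3,4)[OF normal_form_linear] by auto
  qed
  then have ideal: "ideal ?K free"
    by (intro ideal.intro ideal_axioms.intro ring_free_algebra)
      (auto simp: normal_form_mult free_algebra_ops carr free_algebra_mult_closed)
  have "tensor_relations V \<subseteq> ?K"
  proof -
    have "word [v \<oplus>\<^bsub>V\<^esub> w] - (word [v] + word [w]) \<in> ?K"
      if vw: "v \<in> carrier V" "w \<in> carrier V" for v w
    proof -
      have "word [v \<oplus>\<^bsub>V\<^esub> w] - (word [v] + word [w]) \<in> carrier free"
        using vw by (auto simp: carr word_in_supported
          intro!: fa.subspace_diff[OF subspace_supported] fa.subspace_add[OF subspace_supported])
      then show ?thesis using vw embedsD(4)[OF L]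
        by (simp add: normal_form_diff normal_form_add normal_form_word expand_def)
    qed
    moreover have "word [c \<odot>\<^bsub>V\<^esub> v] - scale c (word [v]) \<in> ?K" if v: "v \<in> carrier V" for c v
    proof -
      have "word [c \<odot>\<^bsub>V\<^esub> v] - scale c (word [v]) \<in> carrier free"
        using v by (auto simp: carr word_in_supported
          intro!: fa.subspace_diff[OF subspace_supported] fa.subspace_scale[OF subspace_supported])
      then show ?thesis using v embedsD(6)[OF L]
        by (simp add: normal_form_diff normal_form_scale normal_form_word expand_def)
    qed
    ultimately show ?thesis unfolding tensor_relations_def scale_def[symmetric] by blast
  qed
  then show "tensor_ideal V \<subseteq> ?K"
    unfolding tensor_ideal_def by (rule free.genideal_minimal[OF ideal])
  show "?K \<subseteq> tensor_ideal V"
    unfolding tensor_ideal_def genideal_def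
  proof (rule Inter_greatest, clarify)
    fix I p assume I: "ideal I free" and rel: "tensor_relations V \<subseteq> I"
      and p: "p \<in> carrier free" "normal_form p = 0"
    interpret I: ideal I free by (rule I)
    have I0: "0 \<in> I" using I.zero_closed by (simp add: free_algebra_ops)
    have Iadd: "a + b \<in> I" if "a \<in> I" "b \<in> I" for a b
      using I.a_closed[OF that] by (simp add: free_algebra_ops)
    have Ileft: "x * a \<in> I" if "a \<in> I" "x \<in> supported (lists (carrier V))" for a x
      using I.I_l_closed[of a x] that by (simp add: free_algebra_ops carr)
    have Iright: "a * x \<in> I" if "a \<in> I" "x \<in> supported (lists (carrier V))" for a x
      using I.I_r_closed[of a x] that by (simp add: free_algebra_ops carr)
    have Iscale: "scale c a \<in> I" if "a \<in> I" for a c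
      unfolding scale_def using that
      by (rule Ileft) (auto simp: supported_def)
    have Isum: "(\<Sum>x\<in>S. f x) \<in> I" if "\<And>x. x \<in> S \<Longrightarrow> f x \<in> I" for S and f :: "'v list \<Rightarrow> _"
      using that by (induction S rule: infinite_finite_induct) (auto simp: I0 Iadd)
    have rel_add: "word [v \<oplus>\<^bsub>V\<^esub> w] - (word [v] + word [w]) \<in> I"
      if "v \<in> carrier V" "w \<in> carrier V" for v w
      using rel that by (auto simp: tensor_relations_def)
    have rel_scale: "word [c \<odot>\<^bsub>V\<^esub> v] - scale c (word [v]) \<in> I" if "v \<in> carrier V" for c v
      using rel that by (auto simp: tensor_relations_def scale_def)
    have zero: "word [\<zero>\<^bsub>V\<^esub>] \<in> I"
      using rel_scale[of "\<zero>\<^bsub>V\<^esub>" 0] V.lmult_0[of "\<zero>\<^bsub>V\<^esub>"] by simp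
    have letter: "word [v] - L v \<in> I" if v: "v \<in> carrier V" for v
    proof -
      obtain a A where A: "finite A" "A \<subseteq> X" "v = V.lincomb a A"
        using v unfolding span_X[symmetric] V.span_def by auto
      have "word [V.lincomb a A] - (\<Sum>x\<in>A. scale (a x) (word [x])) \<in> I"
        using A(1,2)
      proof (induction A)
        case empty
        then show ?case using zero by (simp add: V.lincomb_def)
      next
        case (insert x A)
        have xA: "x \<in> carrier V" "A \<subseteq> carrier V" using insert.prems X by auto
        let ?l = "V.lincomb a A"
        have l: "?l \<in> carrier V" using xA by (intro V.lincomb_closed) auto
        have ax: "a x \<odot>\<^bsub>V\<^esub> x \<in> carrier V" using xA(1) by simp
        have "V.lincomb a (insert x A) = a x \<odot>\<^bsub>V\<^esub> x \<oplus>\<^bsub>V\<^esub> ?l"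
          unfolding V.lincomb_def using insert.hyps xA
          by (intro V.finsum_insert) (auto intro!: V.smult_closed)
        then have "word [V.lincomb a (insert x A)] - (\<Sum>y\<in>insert x A. scale (a y) (word [y]))
          = (word [a x \<odot>\<^bsub>V\<^esub> x \<oplus>\<^bsub>V\<^esub> ?l] - (word [a x \<odot>\<^bsub>V\<^esub> x] + word [?l]))
          + ((word [a x \<odot>\<^bsub>V\<^esub> x] - scale (a x) (word [x]))
          + (word [?l] - (\<Sum>y\<in>A. scale (a y) (word [y]))))"
          using insert.hyps by simp
        moreover have "\<dots> \<in> I"
          using insert.prems by (intro Iadd rel_add rel_scale insert.IH ax l xA(1)) auto
        ultimately show ?case by simp
      qed
      moreover have "L v = (\<Sum>x\<in>A. scale (a x) (word [x]))"
        unfolding A(3) using A(2) X L_letter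
        by (subst embeds_lincomb[OF L]) (auto intro!: sum.cong)
      ultimately show ?thesis using A(3) by simp
    qed
    have word: "word w - expand w \<in> I" if "w \<in> lists (carrier V)" for w
      using that
    proof (induction w)
      case Nil
      then show ?case by (simp add: expand_def word_Nil I0)
    next
      case (Cons v w)
      have "word (v # w) - expand (v # w)
          = (word [v] - L v) * word w + L v * (word w - expand w)"
        by (simp add: expand_def algebra_simps word_mult)
      moreover have "\<dots> \<in> I"
        using Cons by (intro Iadd Iright Ileft letter)
          (auto simp: word_in_supported intro: supported_free L_supported)
      ultimately show ?case by simp
    qed
    have "p = lin_ext word p - normal_form p" using p by (simp add: lin_ext_word_id)
    also have "\<dots> = (\<Sum>w\<in>Poly_Mapping.keys p. scale (Poly_Mapping.lookup p w) (word w - expand w))"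
      by (simp add: normal_form_def lin_ext_def sum_subtractf fa.scale_right_diff_distrib)
    also have "\<dots> \<in> I"
      using p(1) by (intro Isum Iscale word) (auto simp: carr supported_def)
    finally show "p \<in> I" .
  qed
qed

definition coord :: "('v list \<Rightarrow>\<^sub>0 'k) set \<Rightarrow> ('v list \<Rightarrow>\<^sub>0 'k)" where
  "coord = on_coset normal_form"

abbreviation T :: "('k, ('v list \<Rightarrow>\<^sub>0 'k) set) module" where
  "T \<equiv> tensor_algebra V"

lemma coord_embeds: "embeds T coord"
  unfolding coord_def tensor_algebra_def
  by (rule quotient_embeds[OF free_vs.vectorspace_axioms normal_form_linear tensor_ideal_eq])

lemma carrier_T: "carrier T = (\<lambda>p. tensor_ideal V +>\<^bsub>free\<^esub> p) ` carrier free"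
  unfolding tensor_algebra_def
  by (rule carrier_quotient[OF free_vs.vectorspace_axioms normal_form_linear tensor_ideal_eq])

lemma coord_coset: "p \<in> carrier free \<Longrightarrow> coord (tensor_ideal V +>\<^bsub>free\<^esub> p) = normal_form p"
  unfolding coord_def
  by (rule on_coset[OF free_vs.vectorspace_axioms normal_form_linear tensor_ideal_eq])

lemma coord_image: "coord ` carrier T = supported (lists X)"
proof -
  have "coord ` carrier T = normal_form ` supported (lists (carrier V))"
    unfolding carrier_T image_image by (auto simp: coord_coset carrier_free_algebra)
  also have "\<dots> = supported (lists X)"
    using normal_form_supported normal_form_id supported_free by force
  finally show ?thesis .
qed

lemma coord_mult:
  assumes "x \<in> carrier T" "y \<in> carrier T"
  shows "x \<otimes>\<^bsub>T\<^esub> y \<in> carrier T" "coord (x \<otimes>\<^bsub>T\<^esub> y) = coord x * coord y"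
proof -
  obtain p q where p: "p \<in> carrier free" "x = tensor_ideal V +>\<^bsub>free\<^esub> p"
    and q: "q \<in> carrier free" "y = tensor_ideal V +>\<^bsub>free\<^esub> q"
    using assms by (auto simp: carrier_T)
  have "x \<otimes>\<^bsub>T\<^esub> y = tensor_ideal V +>\<^bsub>free\<^esub> (p \<otimes>\<^bsub>free\<^esub> q)"
    unfolding tensor_algebra_def p q
    by (rule quotient_mult[OF free_vs.vectorspace_axioms normal_form_linear tensor_ideal_eq p(1) q(1)])
      (simp_all add: carrier_free_algebra free_algebra_ops free_algebra_mult_closed normal_form_mult)
  moreover have "p \<otimes>\<^bsub>free\<^esub> q \<in> carrier free" using p q by simp
  ultimately show "x \<otimes>\<^bsub>T\<^esub> y \<in> carrier T" "coord (x \<otimes>\<^bsub>T\<^esub> y) = coord x * coord y"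
    using p q by (auto simp: carrier_T coord_coset normal_form_mult free_algebra_ops)
qed

lemma homogeneous_carrier: "homogeneous_lists G n e \<subseteq> lists (carrier V)"
proof
  fix w assume "w \<in> homogeneous_lists G n e"
  then obtain ds where "list_all2 (\<lambda>v d. d \<in> bidegrees \<and> v \<in> G (fst d) (snd d)) w ds"
    by (auto simp: homogeneous_lists_def)
  then show "w \<in> lists (carrier V)"
    by (induction rule: list_all2_induct) (use component_carrier[THEN subsetD] in \<open>auto simp: bidegrees_def\<close>)
qed

lemma expand_homogeneous:
  assumes "w \<in> homogeneous_lists G n e"
  shows "expand w \<in> supported (words_of n e)"
proof -
  obtain ds where ds: "list_all2 (\<lambda>v d. d \<in> bidegrees \<and> v \<in> G (fst d) (snd d)) w ds"
    and n: "sum_list (map fst ds) = n" and e: "sum_list (map snd ds) = e"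
    using assms by (auto simp: homogeneous_lists_def)
  show ?thesis
    using ds unfolding n[symmetric] e[symmetric]
  proof (induction rule: list_all2_induct)
    case Nil
    then show ?case by (simp add: expand_def word_in_supported flip: word_Nil)
  next
    case (Cons v w d ds)
    have "1 \<le> fst d" "L v \<in> L ` G (fst d) (snd d)" using Cons.hyps by (auto simp: bidegrees_def)
    then have "L v \<in> supported (letters {x \<in> X. wt x = fst d \<and> par x = snd d})"
      using L_component[of "fst d" "snd d"] by blast
    then have "L v * expand w \<in> supported (words_of (fst d + sum_list (map fst ds))
        (snd d + sum_list (map snd ds)))"
      by (rule supported_mult[OF _ Cons.IH]) auto
    then show ?case by (simp only: expand_def list.map prod_list.Cons sum_list.Cons)
  qed
qed

lemma words_homogeneous: "words_of n e \<subseteq> homogeneous_lists G n e"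
proof
  fix w assume w: "w \<in> words_of n e"
  have "x \<in> G (wt x) (par x)" if x: "x \<in> X" for x
  proof -
    have "L x \<in> L ` G (wt x) (par x)"
      using L_component[of "wt x" "par x"] wt_pos[OF x] x by (simp add: L_letter word_in_supported)
    then show ?thesis
      using embedsD(7)[OF L] component_carrier[OF wt_pos[OF x]] x X by blast
  qed
  then have "list_all2 (\<lambda>v d. d \<in> bidegrees \<and> v \<in> G (fst d) (snd d)) w (map (\<lambda>x. (wt x, par x)) w)"
    using w wt_pos by (auto simp: list_all2_conv_all_nth bidegrees_def in_lists_conv_set)
  then show "w \<in> homogeneous_lists G n e"
    using w unfolding homogeneous_lists_def
    by (intro CollectI exI[of _ "map (\<lambda>x. (wt x, par x)) w"]) (simp add: comp_def)
qed

lemma pure_tensor_carrier: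
  assumes "w \<in> lists (carrier V)"
  shows "pure_tensor V w \<in> carrier T" "coord (pure_tensor V w) = expand w"
  using assms unfolding pure_tensor_def
  by (auto simp: carrier_T coord_coset carrier_free_algebra word_in_supported normal_form_word)

lemma component_coord:
  "coord ` tensor_component V G n e = supported (words_of n e)"
  "tensor_component V G n e \<subseteq> carrier T"
proof -
  have sub: "pure_tensor V ` homogeneous_lists G n e \<subseteq> carrier T"
    using homogeneous_carrier pure_tensor_carrier by blast
  show "tensor_component V G n e \<subseteq> carrier T"
    unfolding tensor_component_def by (rule embeds_span(2)[OF coord_embeds sub])
  have "coord ` tensor_component V G n e = fa.span (expand ` homogeneous_lists G n e)"
    unfolding tensor_component_def embeds_span(1)[OF coord_embeds sub] image_image
    using homogeneous_carrier pure_tensor_carrier(2)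
    by (intro arg_cong[of _ _ fa.span] image_cong refl) blast
  also have "\<dots> = supported (words_of n e)"
  proof
    show "fa.span (expand ` homogeneous_lists G n e) \<subseteq> supported (words_of n e)"
      by (rule fa.span_minimal[OF _ subspace_supported]) (use expand_homogeneous in blast)
    have "word ` words_of n e \<subseteq> expand ` homogeneous_lists G n e"
    proof (rule image_subsetI)
      fix w assume w: "w \<in> words_of n e"
      then have "word w = expand w" by (simp add: expand_letters)
      moreover have "w \<in> homogeneous_lists G n e" using w words_homogeneous by blast
      ultimately show "word w \<in> expand ` homogeneous_lists G n e" by (rule image_eqI)
    qed
    then show "supported (words_of n e) \<subseteq> fa.span (expand ` homogeneous_lists G n e)"
      unfolding supported_eq_span by (rule fa.span_mono)
  qed
  finally show "coord ` tensor_component V G n e = supported (words_of n e)" .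
qed

lemma plus_coord:
  "coord ` tensor_plus V G = supported (lists X - {[]})"
  "tensor_plus V G \<subseteq> carrier T"
proof -
  have sub: "(\<Union>(n, e)\<in>bidegrees. tensor_component V G n e) \<subseteq> carrier T"
    using component_coord(2) by auto
  show "tensor_plus V G \<subseteq> carrier T"
    unfolding tensor_plus_def by (rule embeds_span(2)[OF coord_embeds sub])
  have "coord ` tensor_plus V G = fa.span (\<Union>(n, e)\<in>bidegrees. supported (words_of n e))"
    unfolding tensor_plus_def embeds_span(1)[OF coord_embeds sub] image_UN
    by (simp add: case_prod_unfold component_coord(1))
  also have "\<dots> = supported (\<Union>(n, e)\<in>bidegrees. words_of n e)"
    unfolding case_prod_unfold by (rule supported_UN_span)
  also have "(\<Union>(n, e)\<in>bidegrees. words_of n e) = lists X - {[]}"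
  proof (intro equalityI subsetI)
    fix w assume w: "w \<in> lists X - {[]}"
    then have "1 \<le> weight w" using length_le_weight[of w] by (cases w) auto
    then show "w \<in> (\<Union>(n, e)\<in>bidegrees. words_of n e)"
      using w by (auto simp: bidegrees_def)
  qed (auto simp: bidegrees_def)
  finally show "coord ` tensor_plus V G = supported (lists X - {[]})" .
qed

text \<open>
  Coordinates turn the graded commutators of homogeneous tensors into those of homogeneous polynomials
  in the letters, whose span is the kernel of the cyclic average on positive weight.
\<close>

lemma commutator_space_eq:
  "commutator_space V G = {x \<in> tensor_plus V G. lin_ext cyclic_mean (coord x) = 0}"
proof -
  let ?C = "{a \<otimes>\<^bsub>T\<^esub> b \<ominus>\<^bsub>T\<^esub> (koszul_sign d e \<odot>\<^bsub>T\<^esub> (b \<otimes>\<^bsub>T\<^esub> a)) | a b m d n e.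
        a \<in> tensor_component V G m d \<and> b \<in> tensor_component V G n e}"
  note E = embedsD[OF coord_embeds]
  have gen: "a \<otimes>\<^bsub>T\<^esub> b \<ominus>\<^bsub>T\<^esub> (koszul_sign d e \<odot>\<^bsub>T\<^esub> (b \<otimes>\<^bsub>T\<^esub> a)) \<in> carrier T"
    "coord (a \<otimes>\<^bsub>T\<^esub> b \<ominus>\<^bsub>T\<^esub> (koszul_sign d e \<odot>\<^bsub>T\<^esub> (b \<otimes>\<^bsub>T\<^esub> a)))
      = coord a * coord b - scale (koszul_sign d e) (coord b * coord a)"
    if "a \<in> tensor_component V G m d" "b \<in> tensor_component V G n e" for a b m d n e
  proof -
    have ab: "a \<in> carrier T" "b \<in> carrier T" using that component_coord(2) by blast+
    show "a \<otimes>\<^bsub>T\<^esub> b \<ominus>\<^bsub>T\<^esub> (koszul_sign d e \<odot>\<^bsub>T\<^esub> (b \<otimes>\<^bsub>T\<^esub> a)) \<in> carrier T"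
      by (intro embeds_minus(1)[OF coord_embeds] coord_mult ab E(5))
    show "coord (a \<otimes>\<^bsub>T\<^esub> b \<ominus>\<^bsub>T\<^esub> (koszul_sign d e \<odot>\<^bsub>T\<^esub> (b \<otimes>\<^bsub>T\<^esub> a)))
      = coord a * coord b - scale (koszul_sign d e) (coord b * coord a)"
      using ab by (simp only: embeds_minus(2)[OF coord_embeds] coord_mult E(5,6))
  qed
  have C: "?C \<subseteq> carrier T" using gen(1) by blast
  have "coord ` ?C = commutators"
  proof (intro equalityI subsetI)
    fix c assume "c \<in> coord ` ?C"
    then obtain a b m d n e where ab: "a \<in> tensor_component V G m d" "b \<in> tensor_component V G n e"
      and c: "c = coord (a \<otimes>\<^bsub>T\<^esub> b \<ominus>\<^bsub>T\<^esub> (koszul_sign d e \<odot>\<^bsub>T\<^esub> (b \<otimes>\<^bsub>T\<^esub> a)))" by blast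
    have "coord a \<in> supported (words_of m d)" "coord b \<in> supported (words_of n e)"
      using ab component_coord(1) by blast+
    then show "c \<in> commutators" unfolding c gen(2)[OF ab] commutators_def by blast
  next
    fix c assume "c \<in> (commutators :: ('v list \<Rightarrow>\<^sub>0 'k) set)"
    then obtain p q m d n e where c: "c = p * q - scale (koszul_sign d e) (q * p)"
      and pq: "p \<in> supported (words_of m d)" "q \<in> supported (words_of n e)"
      unfolding commutators_def by blast
    obtain a b where ab: "a \<in> tensor_component V G m d" "b \<in> tensor_component V G n e"
      and "p = coord a" "q = coord b"
      using pq unfolding component_coord(1)[symmetric] by blast
    then have "c = coord (a \<otimes>\<^bsub>T\<^esub> b \<ominus>\<^bsub>T\<^esub> (koszul_sign d e \<odot>\<^bsub>T\<^esub> (b \<otimes>\<^bsub>T\<^esub> a)))"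
      unfolding c gen(2)[OF ab] by simp
    then show "c \<in> coord ` ?C" using ab by blast
  qed
  then have image: "coord ` commutator_space V G = fa.span commutators"
    unfolding commutator_space_def using embeds_span(1)[OF coord_embeds C] by simp
  have carr: "commutator_space V G \<subseteq> carrier T"
    unfolding commutator_space_def by (rule embeds_span(2)[OF coord_embeds C])
  show ?thesis
  proof (intro equalityI subsetI)
    fix x assume x: "x \<in> commutator_space V G"
    then have "coord x \<in> fa.span commutators" using image by blast
    then have cx: "coord x \<in> supported (lists X - {[]})" "lin_ext cyclic_mean (coord x) = 0"
      unfolding span_commutators_eq by simp_all
    then have "coord x \<in> coord ` tensor_plus V G" by (simp add: plus_coord(1))
    then have "x \<in> tensor_plus V G" using E(7) carr plus_coord(2) x by blast
    then show "x \<in> {x \<in> tensor_plus V G. lin_ext cyclic_mean (coord x) = 0}" using cx by simp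
  next
    fix x assume x: "x \<in> {x \<in> tensor_plus V G. lin_ext cyclic_mean (coord x) = 0}"
    then have "coord x \<in> fa.span commutators"
      unfolding span_commutators_eq using plus_coord(1) by blast
    then show "x \<in> commutator_space V G" using image E(7) carr plus_coord(2) x by blast
  qed
qed

section \<open>Reduced cyclic homology in coordinates\<close>

abbreviation plus :: "('k, ('v list \<Rightarrow>\<^sub>0 'k) set) module" where
  "plus \<equiv> T\<lparr>carrier := tensor_plus V G\<rparr>"

text \<open>
  The coordinates of a class in \<open>T(V)\<^sup>+ / [T(V), T(V)]\<close>: the cyclic average of any representative.
\<close>

definition cyclic_coord :: "('v list \<Rightarrow>\<^sub>0 'k) set set \<Rightarrow> ('v list \<Rightarrow>\<^sub>0 'k)" where
  "cyclic_coord = on_coset (\<lambda>x. lin_ext cyclic_mean (coord x))"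

lemma plus_embeds: "embeds plus coord"
  by (rule embeds_restrict(1)[OF coord_embeds plus_coord(2)])
    (simp add: plus_coord(1) subspace_supported)

lemma plus_vectorspace: "vectorspace class_ring plus"
  by (rule embeds_vectorspace[OF plus_embeds])

lemma plus_linear: "linear_on plus (\<lambda>x. lin_ext cyclic_mean (coord x))"
  using embedsD(1-6)[OF plus_embeds]
  by (simp add: linear_on_def lin_ext_add lin_ext_scale)

lemma commutator_space_kernel:
  "commutator_space V G = {x \<in> carrier plus. lin_ext cyclic_mean (coord x) = 0}"
  by (simp add: commutator_space_eq)

lemma HC0_embeds: "embeds (HC0 V G) cyclic_coord"
  unfolding HC0_def cyclic_coord_def
  by (rule quotient_embeds[OF plus_vectorspace plus_linear commutator_space_kernel])

lemma coset_plus: "N +>\<^bsub>plus\<^esub> x = N +>\<^bsub>T\<^esub> x"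
  by (simp add: a_r_coset_def')

lemma carrier_HC0: "carrier (HC0 V G) = (\<lambda>x. commutator_space V G +>\<^bsub>T\<^esub> x) ` tensor_plus V G"
  unfolding HC0_def
  using carrier_quotient[OF plus_vectorspace plus_linear commutator_space_kernel]
  by (simp add: coset_plus)

lemma cyclic_coord_coset:
  "x \<in> tensor_plus V G \<Longrightarrow>
    cyclic_coord (commutator_space V G +>\<^bsub>T\<^esub> x) = lin_ext cyclic_mean (coord x)"
  using on_coset[OF plus_vectorspace plus_linear commutator_space_kernel, of x]
  by (simp add: cyclic_coord_def coset_plus)

lemma cyclic_coord_image:
  "Y \<subseteq> tensor_plus V G \<Longrightarrow> cyclic_coord ` (\<lambda>x. commutator_space V G +>\<^bsub>T\<^esub> x) ` Y
    = lin_ext cyclic_mean ` coord ` Y"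
  unfolding image_image using cyclic_coord_coset by (intro image_cong refl) blast

lemma HC0_image: "cyclic_coord ` carrier (HC0 V G) = lin_ext cyclic_mean ` supported (lists X - {[]})"
  unfolding carrier_HC0 cyclic_coord_image[OF subset_refl] plus_coord(1) ..

lemma component_plus:
  assumes "1 \<le> n"
  shows "tensor_component V G n e \<subseteq> tensor_plus V G"
proof
  fix x assume x: "x \<in> tensor_component V G n e"
  then have "coord x \<in> supported (words_of n e)" using component_coord(1) by blast
  then have "coord x \<in> supported (lists X - {[]})"
    using assms by (auto simp: supported_def)
  then have "coord x \<in> coord ` tensor_plus V G" by (simp add: plus_coord(1))
  then show "x \<in> tensor_plus V G"
    using x embedsD(7)[OF coord_embeds] component_coord(2) plus_coord(2) by blast
qed

lemma HC0_component_image: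
  assumes "1 \<le> n"
  shows "cyclic_coord ` HC0_component V G n e = fa.span (cyclic_mean ` words_of n e)"
    and "HC0_component V G n e \<subseteq> carrier (HC0 V G)"
proof -
  show "cyclic_coord ` HC0_component V G n e = fa.span (cyclic_mean ` words_of n e)"
    unfolding HC0_component_def cyclic_coord_image[OF component_plus[OF assms]]
      component_coord(1) lin_ext_image_supported ..
  show "HC0_component V G n e \<subseteq> carrier (HC0 V G)"
    unfolding HC0_component_def carrier_HC0 by (rule image_mono[OF component_plus[OF assms]])
qed

lemma HC0_component_embeds:
  assumes n: "1 \<le> n"
  shows "embeds (HC0 V G\<lparr>carrier := HC0_component V G n e\<rparr>) cyclic_coord"
    and "VectorSpace.subspace class_ring (HC0_component V G n e) (HC0 V G)"
  using embeds_restrict[OF HC0_embeds HC0_component_image(2)[OF n]] HC0_component_image(1)[OF n]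
  by simp_all

lemma HC0_component_dim:
  assumes n: "1 \<le> n"
  shows "vectorspace.fin_dim class_ring (HC0 V G\<lparr>carrier := HC0_component V G n e\<rparr>)"
    and "of_nat (vectorspace.dim class_ring (HC0 V G\<lparr>carrier := HC0_component V G n e\<rparr>))
      = (\<Sum>w\<in>words_of n e. rotation_trace w :: rat)"
proof -
  let ?H = "HC0 V G\<lparr>carrier := HC0_component V G n e\<rparr>"
  have fin: "finite ((cyclic_mean :: 'v list \<Rightarrow> 'v list \<Rightarrow>\<^sub>0 'k) ` words_of n e)"
    by (rule finite_imageI, rule finite_subset[OF _ finite_words[of n]]) auto
  have image: "cyclic_coord ` carrier ?H = fa.span (cyclic_mean ` words_of n e)"
    using HC0_component_image(1)[OF n] by simp
  note dim = embeds_dim[OF HC0_component_embeds(1)[OF n, of e] fin]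
  show "vectorspace.fin_dim class_ring ?H" by (rule dim(1)) (simp only: image subset_refl)
  have "vectorspace.dim class_ring ?H = fa.dim (cyclic_coord ` carrier ?H)"
    by (rule dim(2)) (simp only: image subset_refl)
  then show "of_nat (vectorspace.dim class_ring ?H) = (\<Sum>w\<in>words_of n e. rotation_trace w :: rat)"
    using dim_cyclic_mean[of n e, where ?'k = 'k] by (simp only: image)
qed

text \<open>
  Rotations preserve weight and sign degree, so the image of the cyclic average is stable under the
  projections to the homogeneous parts.
\<close>

lemma HC0_direct_sum: "is_direct_sum (HC0 V G) (HC0_component V G)"
proof (rule embeds_direct_sum[OF HC0_embeds, where deg = "\<lambda>w. (weight w, parity w)"])
  let ?deg = "\<lambda>w. (weight w, parity w)"
  fix d assume d: "d \<in> bidegrees"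
  then have n: "1 \<le> fst d" by (auto simp: bidegrees_def)
  show "HC0_component V G (fst d) (snd d) \<subseteq> carrier (HC0 V G)"
    by (rule HC0_component_image(2)[OF n])
  have image: "cyclic_coord ` HC0_component V G (fst d) (snd d)
      = lin_ext cyclic_mean ` supported (words_of (fst d) (snd d))"
    by (simp only: HC0_component_image(1)[OF n] lin_ext_image_supported)
  show "cyclic_coord ` HC0_component V G (fst d) (snd d)
      = {p \<in> cyclic_coord ` carrier (HC0 V G). \<forall>w\<in>Poly_Mapping.keys p. ?deg w = d}"
  proof (intro equalityI subsetI)
    fix p assume p: "p \<in> cyclic_coord ` HC0_component V G (fst d) (snd d)"
    then have "p \<in> cyclic_coord ` carrier (HC0 V G)" using HC0_component_image(2)[OF n] by blast
    moreover obtain q where q: "q \<in> supported (words_of (fst d) (snd d))" "p = lin_ext cyclic_mean q"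
      using p image by blast
    have "part (\<lambda>w. ?deg w = d) q = q"
      using q(1) by (intro poly_mapping_eqI) (auto simp: lookup_part supported_def in_keys_iff subset_iff)
    then have "part (\<lambda>w. ?deg w = d) p = p" unfolding q(2) part_cyclic_mean by simp
    then have "\<forall>w\<in>Poly_Mapping.keys p. ?deg w = d" using keys_part[of "\<lambda>w. ?deg w = d" p] by auto
    ultimately show "p \<in> {p \<in> cyclic_coord ` carrier (HC0 V G). \<forall>w\<in>Poly_Mapping.keys p. ?deg w = d}"
      by simp
  next
    fix p assume "p \<in> {p \<in> cyclic_coord ` carrier (HC0 V G). \<forall>w\<in>Poly_Mapping.keys p. ?deg w = d}"
    then obtain q where q: "q \<in> supported (lists X - {[]})" "p = lin_ext cyclic_mean q"
      and deg: "\<forall>w\<in>Poly_Mapping.keys p. ?deg w = d"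
      unfolding HC0_image by blast
    have "p = part (\<lambda>w. ?deg w = d) p"
      using deg by (intro poly_mapping_eqI) (auto simp: lookup_part in_keys_iff)
    then have "p = lin_ext cyclic_mean (part (\<lambda>w. ?deg w = d) q)"
      unfolding q(2) part_cyclic_mean .
    moreover have "part (\<lambda>w. ?deg w = d) q \<in> supported (words_of (fst d) (snd d))"
      using q(1) by (auto simp: supported_def keys_part)
    ultimately show "p \<in> cyclic_coord ` HC0_component V G (fst d) (snd d)"
      unfolding image by blast
  qed
next
  let ?deg = "\<lambda>w. (weight w, parity w)"
  fix p assume "p \<in> cyclic_coord ` carrier (HC0 V G)"
  then obtain q where q: "q \<in> supported (lists X - {[]})" "p = lin_ext cyclic_mean q"
    unfolding HC0_image by blast
  show "part (\<lambda>w. ?deg w = d) p \<in> cyclic_coord ` carrier (HC0 V G)" for d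
  proof -
    have "part (\<lambda>w. ?deg w = d) q \<in> supported (lists X - {[]})"
      using q(1) by (auto simp: supported_def keys_part)
    then show ?thesis unfolding q(2) part_cyclic_mean HC0_image by blast
  qed
  fix w assume w: "w \<in> Poly_Mapping.keys p"
  have "p \<in> supported {v. 1 \<le> weight v}"
    unfolding q(2) lin_ext_def
  proof (intro fa.subspace_sum[OF subspace_supported] fa.subspace_scale[OF subspace_supported])
    fix u assume "u \<in> Poly_Mapping.keys q"
    then have u: "u \<in> lists X" "u \<noteq> []" using q(1) by (auto simp: supported_def)
    then have "1 \<le> weight u" using length_le_weight[of u] by (cases u) auto
    then have "{v. weight v = weight u \<and> parity v = parity u \<and> set v = set u} \<subseteq> {v. 1 \<le> weight v}"
      by auto
    then show "(cyclic_mean u :: 'v list \<Rightarrow>\<^sub>0 'k) \<in> supported {v. 1 \<le> weight v}"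
      using cyclic_mean_supported[of u, where ?'k = 'k] by (rule supported_mono)
  qed
  then show "?deg w \<in> bidegrees" using w by (auto simp: supported_def bidegrees_def)
qed

lemma HC0_fd_bigraded: "fd_bigraded (HC0 V G) (HC0_component V G)"
  unfolding fd_bigraded_def
  using embeds_vectorspace[OF HC0_embeds] HC0_component_embeds(2) HC0_component_dim(1) HC0_direct_sum
  by blast

lemma HC0_series: "bigraded_series (HC0 V G) (HC0_component V G) = trace_series"
proof (rule fps_ext)
  fix n
  show "fps_nth (bigraded_series (HC0 V G) (HC0_component V G)) n = fps_nth trace_series n"
    unfolding bigraded_series_def trace_series_def fps_nth_Abs_fps
    using HC0_component_dim(2)[of n] by (cases "n = 0") simp_all
qed

end

section \<open>The series of reduced cyclic homology\<close>

theorem mainTheorem1: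
  fixes V :: "('k::field_char_0, 'v) module"
    and G :: "nat \<Rightarrow> bit \<Rightarrow> 'v set"
  assumes "fd_bigraded V G"
  shows "fd_bigraded (HC0 V G) (HC0_component V G) \<and>
    (\<lambda>m. - (series_const (of_nat (totient (Suc m)) / of_nat (Suc m)) *
       series_log (1 - series_subst (Suc m) (bigraded_series V G))))
      sums bigraded_series (HC0 V G) (HC0_component V G)"
proof -
  have V: "vectorspace class_ring V" using assms by (simp add: fd_bigraded_def)
  let ?span = "LinearCombinations.module.span class_ring V"
  obtain B where B': "\<forall>d\<in>bidegrees. finite (B d) \<and> B d \<subseteq> G (fst d) (snd d) \<and>
        card (B d) = vectorspace.dim class_ring (V\<lparr>carrier := G (fst d) (snd d)\<rparr>) \<and>
        ?span (B d) = G (fst d) (snd d)"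
    and disj: "\<forall>d\<in>bidegrees. \<forall>d'\<in>bidegrees. d \<noteq> d' \<longrightarrow> B d \<inter> B d' = {}"
    and li: "\<not> LinearCombinations.module.lin_dep class_ring V (\<Union>d\<in>bidegrees. B d)"
    and gen: "?span (\<Union>d\<in>bidegrees. B d) = carrier V"
    using homogeneous_basis[OF assms] by (elim exE conjE) (rule that)
  note B = bspec[OF B']
  define X where "X = (\<Union>d\<in>bidegrees. B d)"
  have "\<forall>x\<in>X. \<exists>d. d \<in> bidegrees \<and> x \<in> B d" by (auto simp: X_def)
  then obtain deg where deg: "\<And>x. x \<in> X \<Longrightarrow> deg x \<in> bidegrees \<and> x \<in> B (deg x)" by metis
  define wt where "wt x = fst (deg x)" for x
  define par where "par x = snd (deg x)" for x
  have letters: "{x \<in> X. wt x = q \<and> par x = e} = B (q, e)" if q: "1 \<le> q" for q e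
  proof (intro equalityI subsetI)
    fix x assume "x \<in> {x \<in> X. wt x = q \<and> par x = e}"
    then have "x \<in> X" "deg x = (q, e)" by (auto simp: wt_def par_def prod_eq_iff)
    then show "x \<in> B (q, e)" using deg by metis
  next
    fix x assume x: "x \<in> B (q, e)"
    have d: "(q, e) \<in> bidegrees" using q by (simp add: bidegrees_def)
    then have "x \<in> X" using x by (auto simp: X_def)
    moreover from this have "deg x = (q, e)" using deg disj d x by blast
    ultimately show "x \<in> {x \<in> X. wt x = q \<and> par x = e}" by (simp add: wt_def par_def)
  qed
  have bideg: "(q, e) \<in> bidegrees" if "1 \<le> q" for q e using that by (simp add: bidegrees_def)
  have alphabet: "graded_alphabet X wt"
  proof
    show pos: "1 \<le> wt x" if "x \<in> X" for x
      using deg[OF that] by (auto simp: wt_def bidegrees_def)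
    show "finite {x \<in> X. wt x = q}" for q
    proof (cases "1 \<le> q")
      case True
      have "{x \<in> X. wt x = q} = (\<Union>e\<in>{0, 1}. {x \<in> X. wt x = q \<and> par x = e})"
        using bit_not_zero_iff by auto
      also have "finite \<dots>"
        using B[OF bideg[OF True]] by (simp only: letters[OF True]) simp
      finally show ?thesis .
    next
      case False
      then have "{x \<in> X. wt x = q} = {}" using pos by auto
      then show ?thesis by (simp only: finite.emptyI)
    qed
  qed
  have X: "X \<subseteq> carrier V"
  proof -
    have "G q e \<subseteq> carrier V" if "1 \<le> q" for q e
      using assms that by (auto simp: fd_bigraded_def subspace_def submodule_def)
    then show ?thesis using B unfolding X_def by (fastforce simp: bidegrees_def)
  qed
  obtain L where L: "embeds V L" "\<And>x. x \<in> X \<Longrightarrow> L x = word [x]"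
    using basis_embedding[OF V X] li gen by (auto simp: X_def)
  interpret graded_alphabet X wt par by (rule alphabet)
  interpret tensor_coordinates X wt par V G L
  proof
    show "?span X = carrier V" using gen by (simp add: X_def)
    show "?span {x \<in> X. wt x = q \<and> par x = e} = G q e" if "1 \<le> q" for q e
      using B[OF bideg[OF that]] by (simp only: letters[OF that] fst_conv snd_conv)
  qed (use X L in auto)
  have "bigraded_series V G = letter_series"
  proof (rule fps_ext)
    fix q
    show "fps_nth (bigraded_series V G) q = fps_nth letter_series q"
      using B[OF bideg[of q]] letters[of q]
      by (cases "q = 0") (simp_all add: bigraded_series_def letter_series_def)
  qed
  then show ?thesis
    using HC0_fd_bigraded trace_series_sums by (simp only: HC0_series)
qed

end
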